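(* Let $n\ge 1$, let $\varepsilon_1,\ldots,\varepsilon_n$ be independent identically distributed Rademacher random variables, i.e. $\mathbb{P}\{\varepsilon_i=1\}=\mathbb{P}\{\varepsilon_i=-1\}=1/2$, let $\mathbf{a}=(a_1,\ldots,a_n)\in\mathbb{R}^n$ be a vector with $a_1^2+\cdots+a_n^2\le 1$, and let $S_n=a_1\varepsilon_1+\cdots+a_n\varepsilon_n$. Let $\eta\sim N(0,1)$ be a standard normal random variable. Then for all $x\in\mathbb{R}$, $$\mathbb{P}\{S_n\ge x\}\le c_\ast\,\mathbb{P}\{\eta\ge x\},\qquad\text{where } c_\ast:=\bigl(4\,\mathbb{P}\{\eta\ge\sqrt{2}\}\bigr)^{-1}.$$
   Context: Numerically, $c_\ast\approx 3.178$. *)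

theory Defs
  imports "HOL-Probability.Probability"
begin

definition c_star :: real where
  "c_star = inverse (4 * measure (density lborel std_normal_density) {sqrt 2..})"

end

theory Submission
  imports Defs
begin

text \<open>
  Write \<open>I\<close> for the standard normal tail and \<open>\<tau>\<close> for the largest \<open>\<bar>a\<^sub>i\<bar>\<close>, and normalize to
  \<open>a\<^sub>1\<^sup>2 + \<dots> + a\<^sub>n\<^sup>2 = 1\<close>. For \<open>x \<le> sqrt 2\<close> symmetry and Chebyshev's inequality suffice.
  For \<open>x \<ge> sqrt 3\<close> one splits off one summand \<open>\<tau> \<epsilon>\<close> and inducts on \<open>n\<close>, using
  \<open>I ((x - \<tau>) / sqrt (1 - \<tau>\<^sup>2)) + I ((x + \<tau>) / sqrt (1 - \<tau>\<^sup>2)) \<le> 2 * I x\<close>.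
  For \<open>x\<close> in between and \<open>x + \<tau> \<ge> sqrt 2 * (x - \<tau>)\<close>, a two-level Chebyshev inequality for the
  remaining summands bounds the tail by \<open>1 / (4 * (x\<^sup>2 - 1))\<close>. Otherwise \<open>\<tau> < 3/10\<close>, and the
  tail is bounded by the expectation of the trigonometric test function \<open>(4/5 - cos (61/50 * s))\<^sup>2\<close>,
  which is a combination of products of cosines. All comparisons with \<open>I x\<close> reduce to the
  endpoints of the interval because the functions involved are unimodal.
\<close>

subsection \<open>The standard normal tail\<close>

definition normal_tail :: "real \<Rightarrow> real" where
  "normal_tail x = measure (density lborel std_normal_density) {x..}"

lemma measure_std_normal:
  assumes "A \<in> sets borel"
  shows "measure (density lborel std_normal_density) A
    = (\<integral>x. std_normal_density x * indicator A x \<partial>lborel)"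
proof -
  have "measure (density lborel std_normal_density) A
      = (\<integral>x. indicator A x \<partial>density lborel std_normal_density)"
    using assms by simp
  also have "\<dots> = (\<integral>x. std_normal_density x * indicator A x \<partial>lborel)"
    using assms by (subst integral_real_density) auto
  finally show ?thesis .
qed

lemma prob_space_std_normal: "prob_space (density lborel std_normal_density)"
  by (rule prob_space_normal_density) simp

lemma measure_std_normal_single: "measure (density lborel std_normal_density) {x} = 0"
proof -
  have "(\<integral>y. std_normal_density y * indicator {x} y \<partial>lborel) = (\<integral>y. 0 \<partial>(lborel :: real measure))"
    by (rule integral_cong_AE) (auto intro!: AE_I[of _ _ "{x}"] simp: indicator_def)
  then show ?thesis by (simp add: measure_std_normal)
qed

text \<open>Reflection x -> -x preserves the density, so the two closed half-lines have equal mass,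
  and the common point 0 is a null set.\<close>

lemma normal_tail_0: "normal_tail 0 = 1 / 2"
proof -
  interpret prob_space "density lborel std_normal_density" by (rule prob_space_std_normal)
  have "measure (density lborel std_normal_density) {0..} = (\<integral>x. std_normal_density x * indicator {0..} x \<partial>lborel)"
    by (simp add: measure_std_normal)
  also have "\<dots> = (\<integral>x. std_normal_density x * indicator {..0} x \<partial>lborel)"
    by (subst lborel_integral_real_affine[of "-1" _ 0]) (auto simp: indicator_def std_normal_density_def intro!: Bochner_Integration.integral_cong)
  also have "\<dots> = measure (density lborel std_normal_density) {..0}"
    by (simp add: measure_std_normal)
  finally have 1: "prob {0..} = prob {..0}" .
  have "prob {..0} = prob ({..<0} \<union> {0})"
    by (rule arg_cong[where f = prob]) auto
  also have "\<dots> = prob {..<0} + prob {0}"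
    by (rule finite_measure_Union) auto
  finally have 2: "prob {..0} = prob {..<0}" by (simp add: measure_std_normal_single)
  have "prob (space (density lborel std_normal_density) - {0..}) = 1 - prob {0..}"
    by (rule prob_compl) simp
  moreover have "space (density lborel std_normal_density) - {0..} = {..<0::real}"
    by auto
  ultimately show ?thesis using 1 2 by (simp add: normal_tail_def)
qed

lemma normal_tail_nonneg: "normal_tail x \<ge> 0"
  by (simp add: normal_tail_def)

lemma normal_tail_antimono: "x \<le> y \<Longrightarrow> normal_tail y \<le> normal_tail x"
proof -
  interpret prob_space "density lborel std_normal_density" by (rule prob_space_std_normal)
  show "x \<le> y \<Longrightarrow> normal_tail y \<le> normal_tail x"
    unfolding normal_tail_def by (rule finite_measure_mono) auto
qed

lemma normal_tail_diff:
  assumes "a \<le> b"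
  shows "normal_tail a - normal_tail b = integral {a..b} std_normal_density"
proof -
  interpret prob_space "density lborel std_normal_density" by (rule prob_space_std_normal)
  have cont: "continuous_on {a..b} std_normal_density"
    unfolding std_normal_density_def by (intro continuous_intros) auto
  have "{a..} = {a..b} \<union> ({b..} - {b})" using assms by auto
  then have "prob {a..} = prob ({a..b} \<union> ({b..} - {b}))" by simp
  also have "\<dots> = prob {a..b} + prob ({b..} - {b})"
    by (rule finite_measure_Union) auto
  also have "prob ({b..} - {b}) = prob {b..}"
    by (subst finite_measure_Diff) (auto simp: measure_std_normal_single)
  finally have "normal_tail a - normal_tail b = prob {a..b}" by (simp add: normal_tail_def)
  also have "\<dots> = set_lebesgue_integral lborel {a..b} std_normal_density"
    by (simp add: measure_std_normal set_lebesgue_integral_def mult.commute)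
  also have "\<dots> = integral {a..b} std_normal_density"
    using borel_integrable_compact[OF compact_Icc cont]
    by (intro set_borel_integral_eq_integral(2)) (simp add: set_integrable_def)
  finally show ?thesis .
qed

text \<open>Near x the tail is a constant minus an integral with moving upper end, so the
  fundamental theorem of calculus applies. The chain rule is built in so that the rule works with
  \<open>derivative_eq_intros\<close>.\<close>

lemma normal_tail_deriv [derivative_intros]:
  assumes "(f has_real_derivative f') (at x)"
  shows "((\<lambda>x. normal_tail (f x)) has_real_derivative - std_normal_density (f x) * f') (at x)"
proof -
  have "(normal_tail has_real_derivative - std_normal_density x) (at x)" for x
  proof -
    have cont: "continuous_on {x-1..x+1} std_normal_density"
      unfolding std_normal_density_def by (intro continuous_intros) auto
    have "((\<lambda>u. integral {x-1..u} std_normal_density) has_real_derivative std_normal_density x)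
        (at x within {x-1..x+1})"
      by (rule integral_has_real_derivative[OF cont]) auto
    then have "((\<lambda>u. integral {x-1..u} std_normal_density) has_real_derivative std_normal_density x) (at x)"
      by (simp add: at_within_Icc_at)
    then have "((\<lambda>u. normal_tail (x-1) - integral {x-1..u} std_normal_density) has_real_derivative - std_normal_density x) (at x)"
      by (auto intro!: derivative_eq_intros)
    moreover have "\<forall>\<^sub>F u in nhds x. u \<in> {x-1<..<x+1}"
      by (rule eventually_nhds_in_open) auto
    then have "\<forall>\<^sub>F u in nhds x. normal_tail (x-1) - integral {x-1..u} std_normal_density = normal_tail u"
    proof eventually_elim
      case (elim u)
      then show ?case using normal_tail_diff[of "x-1" u] by simp
    qed
    ultimately show ?thesis
      by (simp add: DERIV_cong_ev)
  qed
  from DERIV_chain'[OF assms this] show ?thesis by (simp add: mult.commute)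
qed

lemma normal_tail_ge_half: "x \<le> 0 \<Longrightarrow> normal_tail x \<ge> 1 / 2"
  using normal_tail_antimono[of x 0] normal_tail_0 by simp

section \<open>Taylor bounds and numerical values of the normal tail\<close>

text \<open>Integral from 0 to x of the first n Taylor terms of exp (- t^2 / 2), computed term by
  term.\<close>

definition gauss_poly :: "nat \<Rightarrow> real \<Rightarrow> real" where
  "gauss_poly n x = (\<Sum>k<n. (- 1) ^ k * x ^ (2 * k + 1) / (2 ^ k * fact k * real (2 * k + 1)))"

lemma gauss_poly_deriv:
  "(gauss_poly n has_real_derivative (\<Sum>k<n. (- (x\<^sup>2 / 2)) ^ k / fact k)) (at x)"
proof -
  have "((\<lambda>x. (- 1) ^ k * x ^ (2 * k + 1) / (2 ^ k * fact k * real (2 * k + 1)))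
      has_real_derivative (- (x\<^sup>2 / 2)) ^ k / fact k) (at x)" for k
  proof -
    have "((\<lambda>x. (- 1) ^ k * x ^ (2 * k + 1) / (2 ^ k * fact k * real (2 * k + 1)))
      has_real_derivative (- 1) ^ k * (real (2 * k + 1) * x ^ (2 * k)) / (2 ^ k * fact k * real (2 * k + 1))) (at x)"
      by (rule derivative_eq_intros refl | simp)+
    also have "(- 1) ^ k * (real (2 * k + 1) * x ^ (2 * k)) / (2 ^ k * fact k * real (2 * k + 1))
       = (-1) ^ k * x ^ (2 * k) / (2 ^ k * fact k)"
      using nonzero_mult_divide_mult_cancel_right[of "real (2*k+1)" "(-1)^k * x^(2*k)" "2^k * fact k"]
      by (simp add: mult_ac del: of_nat_add of_nat_mult)
    also have "\<dots> = (- (x\<^sup>2 / 2)) ^ k / fact k"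
      by (subst power_minus) (simp add: power_divide power_mult)
    finally show ?thesis .
  qed
  then show ?thesis unfolding gauss_poly_def by (rule DERIV_sum)
qed

text \<open>The Lagrange remainder is a positive multiple of (- v)^n, so its sign depends only on
  the parity of n.\<close>

lemma exp_minus_bounds:
  fixes v :: real
  assumes "v \<ge> 0"
  shows "even n \<Longrightarrow> (\<Sum>k<n. (- v) ^ k / fact k) \<le> exp (- v)"
    and "odd n \<Longrightarrow> exp (- v) \<le> (\<Sum>k<n. (- v) ^ k / fact k)"
proof -
  obtain t where t: "exp (- v) = (\<Sum>k<n. (- v) ^ k / fact k) + (exp t / fact n) * (- v) ^ n"
    using Maclaurin_exp_le[of "- v" n] by blast
  show "even n \<Longrightarrow> (\<Sum>k<n. (- v) ^ k / fact k) \<le> exp (- v)"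
    using t assms by simp
  show "odd n \<Longrightarrow> exp (- v) \<le> (\<Sum>k<n. (- v) ^ k / fact k)"
    using t assms by (simp add: power_minus_odd)
qed

text \<open>The tail plus the normalized polynomial equals 1/2 at 0, and its derivative is the
  Taylor error of the exponential over sqrt (2 * pi), whose sign is fixed by parity.\<close>

lemma normal_tail_bounds:
  assumes "x \<ge> 0"
  shows "even n \<Longrightarrow> normal_tail x \<le> 1 / 2 - gauss_poly n x / sqrt (2 * pi)"
    and "odd n \<Longrightarrow> 1 / 2 - gauss_poly n x / sqrt (2 * pi) \<le> normal_tail x"
proof -
  let ?D = "\<lambda>t. (\<Sum>k<n. (- (t\<^sup>2 / 2)) ^ k / fact k) / sqrt (2 * pi) - std_normal_density t"
  let ?h = "\<lambda>t. normal_tail t + gauss_poly n t / sqrt (2 * pi)"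
  have der: "(?h has_real_derivative ?D t) (at t)" for t
    using DERIV_add[OF normal_tail_deriv[OF DERIV_ident] DERIV_cdivide[OF gauss_poly_deriv, of n "sqrt (2 * pi)"], of t]
    by simp
  have D: "?D t = ((\<Sum>k<n. (- (t\<^sup>2 / 2)) ^ k / fact k) - exp (- (t\<^sup>2 / 2))) / sqrt (2 * pi)" for t
    by (simp add: std_normal_density_def diff_divide_distrib)
  have h0: "?h 0 = 1 / 2" by (simp add: normal_tail_0 gauss_poly_def)
  show "normal_tail x \<le> 1 / 2 - gauss_poly n x / sqrt (2 * pi)" if "even n"
  proof -
    have "?h x \<le> ?h 0"
    proof (rule DERIV_nonpos_imp_nonincreasing[OF assms])
      fix t
      have "?D t \<le> 0" unfolding D using exp_minus_bounds(1)[of "t\<^sup>2 / 2" n] that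
        by (intro divide_nonpos_nonneg) auto
      then show "\<exists>y. (?h has_real_derivative y) (at t) \<and> y \<le> 0" using der by blast
    qed
    then show ?thesis using h0 by simp
  qed
  show "1 / 2 - gauss_poly n x / sqrt (2 * pi) \<le> normal_tail x" if "odd n"
  proof -
    have "?h 0 \<le> ?h x"
    proof (rule DERIV_nonneg_imp_nondecreasing[OF assms])
      fix t
      have "?D t \<ge> 0" unfolding D using exp_minus_bounds(2)[of "t\<^sup>2 / 2" n] that
        by (intro divide_nonneg_nonneg) auto
      then show "\<exists>y. (?h has_real_derivative y) (at t) \<and> y \<ge> 0" using der by blast
    qed
    then show ?thesis using h0 by simp
  qed
qed

lemma std_normal_density_deriv:
  "(std_normal_density has_real_derivative - x * std_normal_density x) (at x)"
proof -
  have "((\<lambda>x. c * exp (- x\<^sup>2 / 2)) has_real_derivative - x * (c * exp (- x\<^sup>2 / 2))) (at x)" for c :: real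
    by (auto intro!: derivative_eq_intros)
  then show ?thesis unfolding std_normal_density_def .
qed

lemma sqrt_bounds:
  "(141421/100000) \<le> sqrt 2" "sqrt 2 \<le> (70711/50000)" "(34641/20000) \<le> sqrt 3" "sqrt 3 \<le> (86603/50000)"
  by (rule real_le_rsqrt real_le_lsqrt; simp add: power2_eq_square)+

text \<open>The first fact serves 0 < x <= 1 and the left endpoint of
  \<open>normal_tail_ge_chebyshev\<close>, the second serves x <= 0, the third anchors
  \<open>times_normal_tail_le\<close>, and the fourth settles the later comparisons at the endpoint
  sqrt 3.\<close>

lemma normal_tail_numeric:
  shows normal_tail_1: "2 * normal_tail (sqrt 2) \<le> normal_tail 1"
    and normal_tail_sqrt2: "normal_tail (sqrt 2) \<le> 1 / 8"
    and normal_tail_sqrt3_le: "normal_tail (sqrt 3) \<le> std_normal_density (sqrt 3) / sqrt 3"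
    and normal_tail_sqrt3_ge: "(523/1000) * normal_tail (sqrt 2) \<le> normal_tail (sqrt 3)"
    and normal_tail_sqrt3_pos: "0 < normal_tail (sqrt 3)"
proof -
  define C where "C = sqrt (2 * pi)"
  have C: "(12533/5000) \<le> C" "C \<le> (25067/10000)"
    unfolding C_def using pi_approx by (intro real_le_rsqrt real_le_lsqrt; simp add: power2_eq_square)+
  note s2 = sqrt_bounds(1,2) and s3 = sqrt_bounds(3,4)
  \<comment> \<open>Odd numbers of terms (5 at 1, 9 at sqrt 3) yield lower bounds of the tail, even
    ones (6 at sqrt 2, 8 at sqrt 3) upper bounds.\<close>
  have p1: "gauss_poly 5 1 \<le> (8557/10000)"
    by (simp add: gauss_poly_def eval_nat_numeral fact_numeral)
  \<comment> \<open>An odd power of sqrt y leaves a single irrational factor, so the remaining sums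
    are rational and can be evaluated.\<close>
  have pow: "sqrt y ^ (2 * k + 1) = sqrt y * y ^ k" if "y \<ge> 0" for y k
    using that by (simp add: power_mult)
  have "gauss_poly 6 (sqrt 2) = sqrt 2 * (\<Sum>k<6. (- 1) ^ k * 2 ^ k / (2 ^ k * fact k * real (2 * k + 1)))"
    unfolding gauss_poly_def by (simp only: pow sum_distrib_left) (simp add: mult_ac)
  also have "(\<Sum>k<6. (- 1) ^ k * 2 ^ k / (2 ^ k * fact k * real (2 * k + 1)) :: real) \<ge> (7467/10000)"
    by (simp add: eval_nat_numeral fact_numeral)
  then have "sqrt 2 * (\<Sum>k<6. (- 1) ^ k * 2 ^ k / (2 ^ k * fact k * real (2 * k + 1)) :: real) \<ge> (141421/100000) * (7467/10000)"
    using s2 by (intro mult_mono) auto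
  finally have p2: "gauss_poly 6 (sqrt 2) \<ge> (10559/10000)" by simp
  have e3: "gauss_poly n (sqrt 3) = sqrt 3 * (\<Sum>k<n. (- 1) ^ k * 3 ^ k / (2 ^ k * fact k * real (2 * k + 1)))" for n
    unfolding gauss_poly_def by (simp only: pow sum_distrib_left) (simp add: mult_ac)
  have "(\<Sum>k<9. (- 1) ^ k * 3 ^ k / (2 ^ k * fact k * real (2 * k + 1)) :: real) \<le> (3317/5000)"
    "0 \<le> (\<Sum>k<9. (- 1) ^ k * 3 ^ k / (2 ^ k * fact k * real (2 * k + 1)) :: real)"
    by (simp_all add: eval_nat_numeral fact_numeral)
  then have "gauss_poly 9 (sqrt 3) \<le> (86603/50000) * (3317/5000)"
    unfolding e3 using s3 by (intro mult_mono) auto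
  then have p3: "gauss_poly 9 (sqrt 3) \<le> (22981/20000)" by simp
  have "(\<Sum>k<8. (- 1) ^ k * 3 ^ k / (2 ^ k * fact k * real (2 * k + 1)) :: real) \<ge> (33/50)"
    by (simp add: eval_nat_numeral fact_numeral)
  then have "gauss_poly 8 (sqrt 3) \<ge> (34641/20000) * (33/50)"
    unfolding e3 using s3 by (intro mult_mono) auto
  then have p4: "gauss_poly 8 (sqrt 3) \<ge> (1143/1000)" by simp
  have C0: "C > 0" using C by simp
  have I1: "normal_tail 1 \<ge> 1 / 2 - (8557/10000) / C"
  proof -
    have "gauss_poly 5 1 / C \<le> (8557/10000) / C" using p1 C0 by (intro divide_right_mono) auto
    then show ?thesis using normal_tail_bounds(2)[of 1 5] by (simp add: C_def)
  qed
  have I2: "normal_tail (sqrt 2) \<le> 1 / 2 - (10559/10000) / C"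
  proof -
    have "gauss_poly 6 (sqrt 2) / C \<ge> (10559/10000) / C" using p2 C0 by (intro divide_right_mono) auto
    then show ?thesis using normal_tail_bounds(1)[of "sqrt 2" 6] by (simp add: C_def)
  qed
  have I3: "normal_tail (sqrt 3) \<ge> 1 / 2 - (22981/20000) / C"
  proof -
    have "gauss_poly 9 (sqrt 3) / C \<le> (22981/20000) / C" using p3 C0 by (intro divide_right_mono) auto
    then show ?thesis using normal_tail_bounds(2)[of "sqrt 3" 9] by (simp add: C_def)
  qed
  have I3': "normal_tail (sqrt 3) \<le> 1 / 2 - (1143/1000) / C"
  proof -
    have "gauss_poly 8 (sqrt 3) / C \<ge> (1143/1000) / C" using p4 C0 by (intro divide_right_mono) auto
    then show ?thesis using normal_tail_bounds(1)[of "sqrt 3" 8] by (simp add: C_def)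
  qed
  have Ci: "(39893/100000) \<le> 1 / C" "1 / C \<le> (7979/20000)" using C C0 by (auto simp: field_simps)
  \<comment> \<open>In this form all remaining estimates are linear in 1 / C.\<close>
  have div: "r / C = r * (1 / C)" for r by simp
  show "2 * normal_tail (sqrt 2) \<le> normal_tail 1"
    using I1 I2 Ci unfolding div[of "(8557/10000)"] div[of "(10559/10000)"] by linarith
  show "normal_tail (sqrt 2) \<le> 1 / 8"
    using I2 Ci unfolding div[of "(10559/10000)"] by linarith
  show "(523/1000) * normal_tail (sqrt 2) \<le> normal_tail (sqrt 3)"
    using I2 I3 Ci unfolding div[of "(22981/20000)"] div[of "(10559/10000)"] by linarith
  show "0 < normal_tail (sqrt 3)"
    using I3 Ci unfolding div[of "(22981/20000)"] by linarith
  show "normal_tail (sqrt 3) \<le> std_normal_density (sqrt 3) / sqrt 3"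
  proof -
    have "(\<Sum>k<6. (- (3/2 :: real)) ^ k / fact k) \<le> exp (- (3/2))" by (rule exp_minus_bounds) auto
    moreover have "(\<Sum>k<6. (- (3/2 :: real)) ^ k / fact k) \<ge> (21/100)"
      by (simp add: eval_nat_numeral fact_numeral)
    ultimately have "exp (- (3/2)) \<ge> ((21/100) :: real)" by linarith
    then have "(21/100) * (1 / C) \<le> exp (- (3/2)) * (1 / C)" using C0 by (intro mult_right_mono) auto
    then have d: "(837/10000) \<le> std_normal_density (sqrt 3)"
      using Ci by (simp add: std_normal_density_def C_def)
    have "normal_tail (sqrt 3) \<le> (441/10000)" using I3' Ci unfolding div[of "(1143/1000)"] by linarith
    then have "normal_tail (sqrt 3) * sqrt 3 \<le> (441/10000) * (86603/50000)"
      using s3 normal_tail_nonneg by (intro mult_mono) auto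
    then show ?thesis using d by (simp add: field_simps)
  qed
qed

lemma normal_tail_pos: "x \<le> sqrt 3 \<Longrightarrow> 0 < normal_tail x"
  using normal_tail_sqrt3_pos normal_tail_antimono[of x "sqrt 3"] by linarith

section \<open>Mills ratio and endpoint comparisons for the normal tail\<close>

text \<open>Factoring the density out of the tail leaves a decreasing function. This gives the
  derivatives below the shape of a nonnegative factor times a decreasing one, as in
  \<open>unimodal_ge_endpoints\<close>.\<close>

definition mills_ratio :: "real \<Rightarrow> real" where
  "mills_ratio x = normal_tail x / std_normal_density x"

lemma normal_tail_mills: "normal_tail x = std_normal_density x * mills_ratio x"
  using normal_density_pos[of 1 0 x] by (simp add: mills_ratio_def)

lemma mills_ratio_nonneg: "mills_ratio x \<ge> 0"
  by (simp add: mills_ratio_def normal_tail_nonneg)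

text \<open>The difference of the two sides has derivative minus the tail, so it decreases and it
  suffices to compare at the right end sqrt 3.\<close>

lemma times_normal_tail_le:
  assumes "x \<le> sqrt 3"
  shows "x * normal_tail x \<le> std_normal_density x"
proof -
  let ?F = "\<lambda>x. std_normal_density x - x * normal_tail x"
  have "?F (sqrt 3) \<le> ?F x"
  proof (rule DERIV_nonpos_imp_nonincreasing[OF assms])
    fix t
    have "(?F has_real_derivative - normal_tail t) (at t)"
      by (auto intro!: derivative_eq_intros std_normal_density_deriv simp: algebra_simps)
    then show "\<exists>d. (?F has_real_derivative d) (at t) \<and> d \<le> 0"
      using normal_tail_nonneg by force
  qed
  then show ?thesis using normal_tail_sqrt3_le by (simp add: field_simps)
qed

lemma mills_ratio_antimono:
  assumes "x \<le> y" "y \<le> sqrt 3"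
  shows "mills_ratio y \<le> mills_ratio x"
proof (rule DERIV_nonpos_imp_nonincreasing[OF assms(1)])
  fix t assume t: "x \<le> t" "t \<le> y"
  have pos: "std_normal_density t > 0" by (rule normal_density_pos) simp
  have "(mills_ratio has_real_derivative t * mills_ratio t - 1) (at t)"
    unfolding mills_ratio_def using pos
    by (auto intro!: derivative_eq_intros std_normal_density_deriv simp: field_simps)
  moreover have "t * mills_ratio t \<le> 1"
    using times_normal_tail_le[of t] t assms pos by (simp add: mills_ratio_def field_simps)
  ultimately show "\<exists>d. (mills_ratio has_real_derivative d) (at t) \<and> d \<le> 0" by force
qed

text \<open>The derivative of \<open>F\<close> changes sign at most once, from plus to minus.\<close>

lemma unimodal_ge_endpoints:
  fixes F p q :: "real \<Rightarrow> real"
  assumes x: "a \<le> x" "x \<le> b"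
    and deriv: "\<And>t. a \<le> t \<Longrightarrow> t \<le> b \<Longrightarrow> (F has_real_derivative p t * q t) (at t)"
    and pos: "\<And>t. a \<le> t \<Longrightarrow> t \<le> b \<Longrightarrow> p t \<ge> 0"
    and anti: "\<And>s t. a \<le> s \<Longrightarrow> s \<le> t \<Longrightarrow> t \<le> b \<Longrightarrow> q t \<le> q s"
    and ends: "c \<le> F a" "c \<le> F b"
  shows "c \<le> F x"
proof (cases "q x \<ge> 0")
  case True
  have "F a \<le> F x"
  proof (rule DERIV_nonneg_imp_nondecreasing[OF x(1)])
    fix t assume t: "a \<le> t" "t \<le> x"
    then have "p t * q t \<ge> 0" using True pos[of t] anti[of t x] x by simp
    then show "\<exists>d. (F has_real_derivative d) (at t) \<and> d \<ge> 0" using deriv[of t] t x by force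
  qed
  then show ?thesis using ends by linarith
next
  case False
  have "F b \<le> F x"
  proof (rule DERIV_nonpos_imp_nonincreasing[OF x(2)])
    fix t assume t: "x \<le> t" "t \<le> b"
    then have "p t * q t \<le> 0" using False pos[of t] anti[of x t] x by (simp add: mult_nonneg_nonpos)
    then show "\<exists>d. (F has_real_derivative d) (at t) \<and> d \<le> 0" using deriv[of t] t x by force
  qed
  then show ?thesis using ends by linarith
qed

text \<open>Makes the Chebyshev bound 1 / (2 * x^2) sufficient on [1, sqrt 2]. Equality holds at
  sqrt 2, where the bound 1/4 is attained by two coefficients 1 / sqrt 2; this explains the value of
  the constant \<open>c_star\<close>.\<close>

lemma normal_tail_ge_chebyshev:
  assumes "1 \<le> x" "x \<le> sqrt 2"
  shows "2 * normal_tail (sqrt 2) \<le> x\<^sup>2 * normal_tail x"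
proof (rule unimodal_ge_endpoints[OF assms,
      where p = "\<lambda>t. t * std_normal_density t" and q = "\<lambda>t. 2 * mills_ratio t - t"])
  fix t :: real assume t: "1 \<le> t" "t \<le> sqrt 2"
  have "((\<lambda>x. x\<^sup>2 * normal_tail x) has_real_derivative
      2 * t * normal_tail t - t\<^sup>2 * std_normal_density t) (at t)"
    by (auto intro!: derivative_eq_intros)
  then show "((\<lambda>x. x\<^sup>2 * normal_tail x) has_real_derivative
      t * std_normal_density t * (2 * mills_ratio t - t)) (at t)"
    by (simp add: normal_tail_mills algebra_simps power2_eq_square)
next
  fix s t :: real assume st: "1 \<le> s" "s \<le> t" "t \<le> sqrt 2"
  moreover have "sqrt 2 \<le> sqrt 3" by simp
  ultimately have "t \<le> sqrt 3" by linarith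
  then show "2 * mills_ratio t - t \<le> 2 * mills_ratio s - s" using st mills_ratio_antimono[of s t] by simp
qed (use normal_tail_1 in auto)

text \<open>Counterpart for the bound 1 / (4 * (x^2 - 1)) of \<open>rad_tail_large_coeff\<close>. It
  is an equality at sqrt 2, and at sqrt 3 it says that the tail is at least half of its value at
  sqrt 2.\<close>

lemma normal_tail_ge_chebyshev2:
  assumes "sqrt 2 \<le> x" "x \<le> sqrt 3"
  shows "normal_tail (sqrt 2) \<le> (x\<^sup>2 - 1) * normal_tail x"
proof (rule unimodal_ge_endpoints[OF assms,
      where p = "\<lambda>t. t * std_normal_density t" and q = "\<lambda>t. 2 * mills_ratio t - t + 1 / t"])
  fix t :: real assume t: "sqrt 2 \<le> t" "t \<le> sqrt 3"
  then have "t > 0" using sqrt_bounds(1) by linarith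
  have "((\<lambda>x. (x\<^sup>2 - 1) * normal_tail x) has_real_derivative
      2 * t * normal_tail t - (t\<^sup>2 - 1) * std_normal_density t) (at t)"
    by (auto intro!: derivative_eq_intros simp: algebra_simps)
  then show "((\<lambda>x. (x\<^sup>2 - 1) * normal_tail x) has_real_derivative
      t * std_normal_density t * (2 * mills_ratio t - t + 1 / t)) (at t)"
    using \<open>t > 0\<close> by (simp add: normal_tail_mills algebra_simps power2_eq_square)
  show "t * std_normal_density t \<ge> 0" using \<open>t > 0\<close> by simp
next
  fix s t :: real assume st: "sqrt 2 \<le> s" "s \<le> t" "t \<le> sqrt 3"
  then have "s > 0" using sqrt_bounds(1) by linarith
  then have "1 / t \<le> 1 / s" using st by (intro divide_left_mono) auto
  then show "2 * mills_ratio t - t + 1 / t \<le> 2 * mills_ratio s - s + 1 / s"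
    using st mills_ratio_antimono[of s t] by simp
qed (use normal_tail_sqrt3_ge normal_tail_nonneg[of "sqrt 2"] in auto)

lemma sin_ge_cubic:
  fixes y :: real
  assumes "0 \<le> y" 
  shows "y - y ^ 3 / 6 - y ^ 5 / 120 \<le> sin y"
proof -
  have "\<bar>sin y - (\<Sum>m<5. sin_coeff m * y ^ m)\<bar> \<le> inverse (fact 5) * \<bar>y\<bar> ^ 5"
    by (rule Maclaurin_sin_bound)
  moreover have "(\<Sum>m<5. sin_coeff m * y ^ m) = y - y ^ 3 / 6"
    by (simp add: eval_nat_numeral sin_coeff_Suc cos_coeff_Suc)
  moreover have "inverse (fact 5) * \<bar>y\<bar> ^ 5 = y ^ 5 / 120"
    using assms by (simp add: fact_numeral field_simps)
  ultimately show ?thesis by linarith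
qed

lemma minus_cos_ge_sin:
  assumes "0 \<le> y" "pi / 2 + y \<le> u" "u \<le> pi"
  shows "sin y \<le> - cos u"
proof -
  have "sin y \<le> sin (u - pi / 2)" using assms by (intro sin_monotone_2pi_le) auto
  then show ?thesis by (simp add: sin_diff)
qed

text \<open>Counterpart for \<open>rad_tail_small_coeffs\<close>: 9/10 is four times the 9/40 there.
  On this interval the angle stays in [pi / 2, pi], where sine, cosine and the Mills ratio all
  decrease, so the second factor of the derivative decreases too.\<close>

lemma normal_tail_ge_trig:
  assumes "sqrt 2 \<le> x" "x \<le> sqrt 3"
  shows "(9/10) * normal_tail (sqrt 2) \<le> ((4/5) - cos ((61/50) * x))\<^sup>2 * normal_tail x"
proof (rule unimodal_ge_endpoints[OF assms,
      where p = "\<lambda>t. ((4/5) - cos ((61/50) * t)) * std_normal_density t"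
        and q = "\<lambda>t. (61/25) * sin ((61/50) * t) * mills_ratio t - ((4/5) - cos ((61/50) * t))"])
  note s2 = sqrt_bounds(1,2) and s3 = sqrt_bounds(3,4)
  have range: "pi / 2 \<le> (61/50) * t" "(61/50) * t \<le> pi" if "sqrt 2 \<le> t" "t \<le> sqrt 3" for t
    using that s2 s3 pi_approx by simp_all
  {
    fix t :: real assume t: "sqrt 2 \<le> t" "t \<le> sqrt 3"
    have "((\<lambda>x. ((4/5) - cos ((61/50) * x))\<^sup>2 * normal_tail x) has_real_derivative
      2 * ((4/5) - cos ((61/50) * t)) * ((61/50) * sin ((61/50) * t)) * normal_tail t
        - ((4/5) - cos ((61/50) * t))\<^sup>2 * std_normal_density t) (at t)"
      by (auto intro!: derivative_eq_intros)
    moreover have "2 * ((4/5) - cos ((61/50) * t)) * ((61/50) * sin ((61/50) * t)) * normal_tail t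
        - ((4/5) - cos ((61/50) * t))\<^sup>2 * std_normal_density t = ((4/5) - cos ((61/50) * t)) * std_normal_density t *
        ((61/25) * sin ((61/50) * t) * mills_ratio t - ((4/5) - cos ((61/50) * t)))"
      unfolding normal_tail_mills by algebra
    ultimately show "((\<lambda>x. ((4/5) - cos ((61/50) * x))\<^sup>2 * normal_tail x) has_real_derivative
      ((4/5) - cos ((61/50) * t)) * std_normal_density t *
        ((61/25) * sin ((61/50) * t) * mills_ratio t - ((4/5) - cos ((61/50) * t)))) (at t)"
      by simp
    have "cos ((61/50) * t) \<le> cos (pi / 2)" using range[OF t] by (subst cos_mono_le_eq) auto
    then have "0 \<le> (4/5) - cos ((61/50) * t)" unfolding cos_pi_half by linarith
    then show "0 \<le> ((4/5) - cos ((61/50) * t)) * std_normal_density t" by (intro mult_nonneg_nonneg) auto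
  }
  {
    fix s t :: real assume st: "sqrt 2 \<le> s" "s \<le> t" "t \<le> sqrt 3"
    have rs: "pi / 2 \<le> (61/50) * s" and rt: "(61/50) * t \<le> pi" using range[of s] range[of t] st by auto
    \<comment> \<open>Shifting by pi moves the angles into [- pi / 2, 0], where sine is increasing,
      and flips the sign.\<close>
    have "- sin ((61/50) * s) \<le> - sin ((61/50) * t)"
      using sin_monotone_2pi_le[of "(61/50) * s - pi" "(61/50) * t - pi"] rs rt st
      by (simp add: sin_diff)
    moreover have "0 \<le> sin ((61/50) * t)" using rs rt st by (intro sin_ge_zero) auto
    ultimately have "sin ((61/50) * t) * mills_ratio t \<le> sin ((61/50) * s) * mills_ratio s"
      using mills_ratio_antimono[of s t] mills_ratio_nonneg st by (intro mult_mono) auto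
    moreover have "cos ((61/50) * t) \<le> cos ((61/50) * s)" using rs rt st by (subst cos_mono_le_eq) auto
    ultimately show "(61/25) * sin ((61/50) * t) * mills_ratio t - ((4/5) - cos ((61/50) * t))
        \<le> (61/25) * sin ((61/50) * s) * mills_ratio s - ((4/5) - cos ((61/50) * s))"
      unfolding mult.assoc by linarith
  }
  show "(9/10) * normal_tail (sqrt 2) \<le> ((4/5) - cos ((61/50) * sqrt 2))\<^sup>2 * normal_tail (sqrt 2)"
  proof (rule mult_right_mono[OF _ normal_tail_nonneg])
    \<comment> \<open>77/500 lies just below 61/50 * sqrt 2 - pi / 2; likewise 271/500 below for
      sqrt 3.\<close>
    have "sin (77/500) \<le> - cos ((61/50) * sqrt 2)"
      using s2 pi_approx by (intro minus_cos_ge_sin) auto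
    moreover have "((3/20) :: real) \<le> sin (77/500)" using sin_ge_cubic[of "(77/500)"] by (simp add: eval_nat_numeral)
    ultimately have "(19/20) \<le> (4/5) - cos ((61/50) * sqrt 2)" by linarith
    from power_mono[OF this, of 2] show "(9/10) \<le> ((4/5) - cos ((61/50) * sqrt 2))\<^sup>2"
      by (simp add: power2_eq_square)
  qed
  show "(9/10) * normal_tail (sqrt 2) \<le> ((4/5) - cos ((61/50) * sqrt 3))\<^sup>2 * normal_tail (sqrt 3)"
  proof -
    have "sin (271/500) \<le> - cos ((61/50) * sqrt 3)"
      using s3 pi_approx by (intro minus_cos_ge_sin) auto
    moreover have "((103/200) :: real) \<le> sin (271/500)" using sin_ge_cubic[of "(271/500)"] by (simp add: eval_nat_numeral)
    ultimately have "(263/200) \<le> (4/5) - cos ((61/50) * sqrt 3)" by linarith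
    from power_mono[OF this, of 2] have "(1729/1000) \<le> ((4/5) - cos ((61/50) * sqrt 3))\<^sup>2"
      by (simp add: power2_eq_square)
    \<comment> \<open>The product of the two constants is about 0.904, just above 9/10.\<close>
    then have "(1729/1000) * ((523/1000) * normal_tail (sqrt 2)) \<le> ((4/5) - cos ((61/50) * sqrt 3))\<^sup>2 * normal_tail (sqrt 3)"
      using normal_tail_sqrt3_ge normal_tail_nonneg by (intro mult_mono) auto
    then show ?thesis using normal_tail_nonneg[of "sqrt 2"] by linarith
  qed
qed

subsection \<open>Weighted Rademacher sums\<close>

text \<open>\<open>rad_exp [a\<^sub>1, \<dots>, a\<^sub>n] f\<close> is the expectation of \<open>f (a\<^sub>1 \<epsilon>\<^sub>1 + \<dots> + a\<^sub>n \<epsilon>\<^sub>n)\<close>.\<close>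

fun rad_exp :: "real list \<Rightarrow> (real \<Rightarrow> real) \<Rightarrow> real" where
  "rad_exp [] f = f 0"
| "rad_exp (a # as) f = (rad_exp as (\<lambda>s. f (s + a)) + rad_exp as (\<lambda>s. f (s - a))) / 2"

lemma rad_exp_const: "rad_exp as (\<lambda>_. c) = c"
  by (induction as) auto

lemma rad_exp_add: "rad_exp as (\<lambda>s. f s + g s) = rad_exp as f + rad_exp as g"
  by (induction as arbitrary: f g) (auto simp: field_simps)

lemma rad_exp_cmult: "rad_exp as (\<lambda>s. c * f s) = c * rad_exp as f"
  by (induction as arbitrary: f) (auto simp: field_simps)

lemma rad_exp_mono: "(\<And>s. f s \<le> g s) \<Longrightarrow> rad_exp as f \<le> rad_exp as g"
proof (induction as arbitrary: f g)
  case (Cons a as)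
  show ?case
    using Cons.IH[of "\<lambda>s. f (s + a)" "\<lambda>s. g (s + a)", OF Cons.prems]
      Cons.IH[of "\<lambda>s. f (s - a)" "\<lambda>s. g (s - a)", OF Cons.prems]
    by simp
qed auto

lemma rad_exp_uminus: "rad_exp as (\<lambda>s. f (- s)) = rad_exp as f"
proof (induction as arbitrary: f)
  case (Cons a as)
  show ?case
    using Cons.IH[of "\<lambda>s. f (s - a)"] Cons.IH[of "\<lambda>s. f (s + a)"] by simp
qed auto

lemma rad_exp_scale: "rad_exp (map ((*) c) as) f = rad_exp as (\<lambda>s. f (c * s))"
  by (induction as arbitrary: f) (auto simp: algebra_simps)

text \<open>Any coefficient may be moved to the front; this is how the largest one is split off
  later.\<close>

lemma rad_exp_insert: "rad_exp (as @ a # bs) f = rad_exp (a # as @ bs) f"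
proof (induction as arbitrary: f)
  case (Cons b as)
  show ?case
    by (simp only: append_Cons rad_exp.simps Cons.IH) (simp add: algebra_simps add_divide_distrib)
qed auto

lemma rad_exp_Cons_abs: "rad_exp (\<bar>a\<bar> # as) f = rad_exp (a # as) f"
  by (cases "a \<ge> 0") auto

lemma rad_exp_square_shift:
  "rad_exp as (\<lambda>s. (s + c)\<^sup>2) = c\<^sup>2 + (\<Sum>a\<leftarrow>as. a\<^sup>2)"
proof (induction as arbitrary: c)
  case (Cons a as)
  show ?case using Cons.IH[of "a + c"] Cons.IH[of "c - a"]
    by (simp add: algebra_simps power2_eq_square)
qed auto

lemma rad_exp_square: "rad_exp as (\<lambda>s. s\<^sup>2) = (\<Sum>a\<leftarrow>as. a\<^sup>2)"
  using rad_exp_square_shift[of as 0] by simp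

text \<open>The free phase c makes the induction work: it absorbs each shift t * a, and cos (c + t *
  a) + cos (c - t * a) = 2 * cos c * cos (t * a).\<close>

lemma rad_exp_cos_shift:
  "rad_exp as (\<lambda>s. cos (t * s + c)) = cos c * (\<Prod>a\<leftarrow>as. cos (t * a))"
proof (induction as arbitrary: c)
  case (Cons a as)
  have "rad_exp as (\<lambda>s. cos (t * (s + a) + c)) = cos (c + t * a) * (\<Prod>a\<leftarrow>as. cos (t * a))"
    using Cons.IH[of "c + t * a"] by (simp add: algebra_simps)
  moreover have "rad_exp as (\<lambda>s. cos (t * (s - a) + c)) = cos (c - t * a) * (\<Prod>a\<leftarrow>as. cos (t * a))"
    using Cons.IH[of "c - t * a"] by (simp add: algebra_simps)
  ultimately show ?case
    by (simp only: rad_exp.simps list.map prod_list.Cons cos_add[of c] cos_diff[of c]) (simp add: field_simps)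
qed auto

lemma rad_exp_cos: "rad_exp as (\<lambda>s. cos (t * s)) = (\<Prod>a\<leftarrow>as. cos (t * a))"
  using rad_exp_cos_shift[of as t 0] by simp

lemma rad_exp_exp_shift:
  "rad_exp as (\<lambda>s. exp (t * s + c)) = exp c * (\<Prod>a\<leftarrow>as. cosh (t * a))"
proof (induction as arbitrary: c)
  case (Cons a as)
  have "rad_exp as (\<lambda>s. exp (t * (s + a) + c)) = exp (c + t * a) * (\<Prod>a\<leftarrow>as. cosh (t * a))"
    using Cons.IH[of "c + t * a"] by (simp add: algebra_simps)
  moreover have "rad_exp as (\<lambda>s. exp (t * (s - a) + c)) = exp (c - t * a) * (\<Prod>a\<leftarrow>as. cosh (t * a))"
    using Cons.IH[of "c - t * a"] by (simp add: algebra_simps)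
  ultimately show ?case
    by (simp add: cosh_def exp_add exp_diff exp_minus field_simps)
qed auto

section \<open>Tail bounds from majorants\<close>

definition rad_tail :: "real list \<Rightarrow> real \<Rightarrow> real" where
  "rad_tail as x = rad_exp as (\<lambda>s. of_bool (s \<ge> x))"

lemma rad_tail_Cons: "rad_tail (a # as) x = (rad_tail as (x - a) + rad_tail as (x + a)) / 2"
  by (simp add: rad_tail_def algebra_simps)

lemma rad_tail_insert: "rad_tail (as @ a # bs) x = rad_tail (a # as @ bs) x"
  unfolding rad_tail_def by (rule rad_exp_insert)

lemma rad_tail_Cons_abs: "rad_tail (\<bar>a\<bar> # as) x = rad_tail (a # as) x"
  unfolding rad_tail_def by (rule rad_exp_Cons_abs)

lemma rad_tail_scale:
  assumes "c > 0"
  shows "rad_tail (map ((*) c) as) (c * x) = rad_tail as x"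
  using assms by (simp add: rad_tail_def rad_exp_scale)

lemma rad_tail_le_1: "rad_tail as x \<le> 1"
  using rad_exp_mono[of "\<lambda>s. of_bool (s \<ge> x)" "\<lambda>_. 1" as]
  by (simp add: rad_tail_def rad_exp_const)

text \<open>By symmetry of the sum, the two-sided indicator has expectation twice the tail. This is
  the source of the factor 1/2 in the Chebyshev bounds.\<close>

lemma rad_tail_le_majorant:
  assumes "\<And>s. of_bool (s \<ge> x) + of_bool (- s \<ge> x) \<le> f s"
  shows "rad_tail as x \<le> rad_exp as f / 2"
proof -
  have "rad_exp as (\<lambda>s. of_bool (s \<ge> x) + of_bool (- s \<ge> x)) \<le> rad_exp as f"
    by (rule rad_exp_mono) (rule assms)
  then show ?thesis
    using rad_exp_uminus[of as "\<lambda>s. of_bool (s \<ge> x)"] by (simp add: rad_tail_def rad_exp_add)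
qed

lemma rad_tail_le_half: "x > 0 \<Longrightarrow> rad_tail as x \<le> 1 / 2"
  using rad_tail_le_majorant[of x "\<lambda>_. 1" as] by (auto simp: rad_exp_const)

lemma rad_tail_chebyshev:
  assumes "x > 0"
  shows "rad_tail as x \<le> (\<Sum>a\<leftarrow>as. a\<^sup>2) / (2 * x\<^sup>2)"
proof -
  have "rad_tail as x \<le> rad_exp as (\<lambda>s. 1 / x\<^sup>2 * s\<^sup>2) / 2"
  proof (rule rad_tail_le_majorant)
    fix s :: real
    have "1 \<le> 1 / x\<^sup>2 * s\<^sup>2" if "\<bar>s\<bar> \<ge> x"
      using assms that power_mono[of x "\<bar>s\<bar>" 2] by (simp add: field_simps)
    then show "of_bool (s \<ge> x) + of_bool (- s \<ge> x) \<le> 1 / x\<^sup>2 * s\<^sup>2"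
      using assms by (cases "\<bar>s\<bar> \<ge> x") auto
  qed
  then show ?thesis by (simp only: rad_exp_cmult rad_exp_square) simp
qed

text \<open>\<open>s\<^sup>2 / p\<^sup>2\<close> majorizes the sum of the two-sided indicators at both levels.\<close>

lemma rad_tail_chebyshev2:
  assumes "p > 0" "q\<^sup>2 \<ge> 2 * p\<^sup>2" "q > 0"
  shows "rad_tail as p + rad_tail as q \<le> (\<Sum>a\<leftarrow>as. a\<^sup>2) / (2 * p\<^sup>2)"
proof -
  let ?ind = "\<lambda>s. (of_bool (s \<ge> p) + of_bool (s \<ge> q)) + (of_bool (- s \<ge> p) + of_bool (- s \<ge> q)) :: real"
  have "p\<^sup>2 \<le> q\<^sup>2" using assms(2) zero_le_power2[of p] by linarith
  then have "p \<le> q" by (rule power2_le_imp_le) (use assms(3) in linarith)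
  have "rad_exp as ?ind \<le> rad_exp as (\<lambda>s. 1 / p\<^sup>2 * s\<^sup>2)"
  proof (rule rad_exp_mono)
    fix s :: real
    consider "\<bar>s\<bar> < p" | "p \<le> \<bar>s\<bar>" "\<bar>s\<bar> < q" | "q \<le> \<bar>s\<bar>" by linarith
    then show "?ind s \<le> 1 / p\<^sup>2 * s\<^sup>2"
    proof cases
      case 1
      then have "?ind s = 0" using \<open>p \<le> q\<close> by (auto simp: abs_less_iff)
      then show ?thesis by simp
    next
      case 2
      then have "?ind s \<le> 1" using assms(1) by (auto simp: abs_less_iff)
      moreover have "p\<^sup>2 \<le> s\<^sup>2" using power_mono[OF 2(1), of 2] assms(1) by simp
      then have "1 \<le> 1 / p\<^sup>2 * s\<^sup>2" using assms(1) by simp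
      ultimately show ?thesis by (rule order_trans)
    next
      case 3
      have "?ind s \<le> 2" using assms(1,3) by auto
      moreover have "q\<^sup>2 \<le> s\<^sup>2" using power_mono[OF 3, of 2] assms(3) by simp
      then have "2 * p\<^sup>2 \<le> s\<^sup>2" using assms(2) by linarith
      then have "2 \<le> 1 / p\<^sup>2 * s\<^sup>2" using assms(1) by (simp add: pos_le_divide_eq)
      ultimately show ?thesis by (rule order_trans)
    qed
  qed
  then show ?thesis
    using rad_exp_uminus[of as "\<lambda>s. of_bool (s \<ge> p)"] rad_exp_uminus[of as "\<lambda>s. of_bool (s \<ge> q)"]
    by (simp only: rad_exp_add rad_exp_cmult rad_exp_square rad_tail_def) simp
qed

text \<open>The quotient \<open>(1 - t\<^sup>2) / (x - t)\<^sup>2\<close> is largest at \<open>t = 1 / x\<close>.\<close>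

lemma rad_tail_large_coeff:
  assumes "\<bar>t\<bar> < x" "x > 1" "t\<^sup>2 + (\<Sum>a\<leftarrow>as. a\<^sup>2) \<le> 1" "(x + t)\<^sup>2 \<ge> 2 * (x - t)\<^sup>2"
  shows "rad_tail (t # as) x \<le> 1 / (4 * (x\<^sup>2 - 1))"
proof -
  have "rad_tail (t # as) x = (rad_tail as (x - t) + rad_tail as (x + t)) / 2"
    by (rule rad_tail_Cons)
  \<comment> \<open>One two-level estimate with p = x - t and q = x + t covers both values of the
    split-off sign.\<close>
  also have "\<dots> \<le> (\<Sum>a\<leftarrow>as. a\<^sup>2) / (2 * (x - t)\<^sup>2) / 2"
    using assms by (intro divide_right_mono rad_tail_chebyshev2) auto
  also have "\<dots> \<le> (1 - t\<^sup>2) / (2 * (x - t)\<^sup>2) / 2"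
    using assms by (intro divide_right_mono) auto
  also have "\<dots> = 1 / 4 * ((1 - t\<^sup>2) / (x - t)\<^sup>2)" by simp
  also have "\<dots> \<le> 1 / 4 * (1 / (x\<^sup>2 - 1))"
  proof -
    have "(x - t)\<^sup>2 - (1 - t\<^sup>2) * (x\<^sup>2 - 1) = (1 - x * t)\<^sup>2"
      by (simp add: power2_eq_square algebra_simps)
    then have "(1 - t\<^sup>2) * (x\<^sup>2 - 1) \<le> (x - t)\<^sup>2"
      using zero_le_power2[of "1 - x * t"] by linarith
    moreover have "x\<^sup>2 > 1" using assms by (simp add: one_less_power)
    moreover have "x - t > 0" using assms by auto
    ultimately show ?thesis by (intro mult_left_mono) (auto simp: field_simps)
  qed
  finally show ?thesis by simp
qed

text \<open>Take logarithms: the difference vanishes at 0 and has derivative y - tanh y, which in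
  turn vanishes at 0 and has derivative tanh^2.\<close>

lemma cosh_le_exp_square: "cosh x \<le> exp (x\<^sup>2 / 2)" for x :: real
proof -
  have tanh: "tanh y \<le> y" if "y \<ge> 0" for y :: real
  proof -
    have "(\<lambda>y. y - tanh y) 0 \<le> (\<lambda>y. y - tanh y) y"
    proof (rule DERIV_nonneg_imp_nondecreasing[OF that])
      fix t :: real
      have "((\<lambda>y. y - tanh y) has_real_derivative (tanh t)\<^sup>2) (at t)"
        by (auto intro!: derivative_eq_intros)
      then show "\<exists>d. ((\<lambda>y. y - tanh y) has_real_derivative d) (at t) \<and> d \<ge> 0" by force
    qed
    then show ?thesis by simp
  qed
  have *: "cosh y \<le> exp (y\<^sup>2 / 2)" if "y \<ge> 0" for y :: real
  proof -
    have "(\<lambda>y. y\<^sup>2 / 2 - ln (cosh y)) 0 \<le> (\<lambda>y. y\<^sup>2 / 2 - ln (cosh y)) y"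
    proof (rule DERIV_nonneg_imp_nondecreasing[OF that])
      fix t :: real assume "0 \<le> t"
      moreover have "((\<lambda>y. y\<^sup>2 / 2 - ln (cosh y)) has_real_derivative t - tanh t) (at t)"
        by (auto intro!: derivative_eq_intros simp: tanh_def cosh_real_pos)
      ultimately show "\<exists>d. ((\<lambda>y. y\<^sup>2 / 2 - ln (cosh y)) has_real_derivative d) (at t) \<and> d \<ge> 0"
        using tanh by force
    qed
    then have "ln (cosh y) \<le> y\<^sup>2 / 2" by simp
    then show ?thesis by (metis cosh_real_pos exp_le_cancel_iff exp_ln)
  qed
  from *[of x] *[of "- x"] show ?thesis by (cases "x \<ge> 0") auto
qed

text \<open>Exponential Markov inequality with parameter x, the minimizer of exp (l^2 / 2 - l * x)
  over l.\<close>

lemma rad_tail_hoeffding: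
  assumes "x > 0" "(\<Sum>a\<leftarrow>as. a\<^sup>2) \<le> 1"
  shows "rad_tail as x \<le> exp (- x\<^sup>2 / 2)"
proof -
  have "rad_tail as x \<le> rad_exp as (\<lambda>s. exp (x * s + (- x\<^sup>2)))"
    unfolding rad_tail_def
  proof (rule rad_exp_mono)
    fix s :: real
    have "x * x \<le> x * s" if "s \<ge> x" using that assms by (intro mult_left_mono) auto
    then show "of_bool (s \<ge> x) \<le> exp (x * s + - x\<^sup>2)" by (auto simp: power2_eq_square)
  qed
  also have "\<dots> = exp (- x\<^sup>2) * (\<Prod>a\<leftarrow>as. cosh (x * a))" by (rule rad_exp_exp_shift)
  also have "(\<Prod>a\<leftarrow>as. cosh (x * a)) \<le> exp (x\<^sup>2 / 2 * (\<Sum>a\<leftarrow>as. a\<^sup>2))"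
  proof (induction as)
    case (Cons a as)
    have "cosh (x * a) * (\<Prod>a\<leftarrow>as. cosh (x * a)) \<le> exp ((x * a)\<^sup>2 / 2) * exp (x\<^sup>2 / 2 * (\<Sum>a\<leftarrow>as. a\<^sup>2))"
      using Cons.IH by (intro mult_mono cosh_le_exp_square prod_list_nonneg) auto
    then show ?case by (simp add: exp_add algebra_simps power_mult_distrib add_divide_distrib)
  qed auto
  also have "exp (x\<^sup>2 / 2 * (\<Sum>a\<leftarrow>as. a\<^sup>2)) \<le> exp (x\<^sup>2 / 2)"
    using assms(2) mult_left_mono[OF assms(2), of "x\<^sup>2 / 2"] by simp
  finally show ?thesis by (simp flip: exp_add) 
qed

section \<open>From random variables to coefficient lists\<close>

text \<open>Conditioning on the last sign reproduces the recursion of \<open>rad_exp\<close>. The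
  index list is reversed so that the newest coefficient is the head.\<close>

lemma (in prob_space) prob_rademacher_sum:
  fixes \<epsilon> :: "nat \<Rightarrow> 'a \<Rightarrow> real" and a :: "nat \<Rightarrow> real"
  assumes "indep_vars (\<lambda>_. borel) \<epsilon> {1..n}"
    and "\<And>i. i \<in> {1..n} \<Longrightarrow> \<P>(\<omega> in M. \<epsilon> i \<omega> = 1) = 1 / 2"
    and "\<And>i. i \<in> {1..n} \<Longrightarrow> \<P>(\<omega> in M. \<epsilon> i \<omega> = - 1) = 1 / 2"
  shows "\<P>(\<omega> in M. (\<Sum>i = 1..n. a i * \<epsilon> i \<omega>) \<ge> x) = rad_tail (map a (rev [1..<Suc n])) x"
  using assms
proof (induction n arbitrary: x)
  case 0
  show ?case by (cases "x \<le> 0") (simp_all add: rad_tail_def prob_space)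
next
  case (Suc n)
  define S where "S = (\<lambda>\<omega>. \<Sum>i = 1..n. a i * \<epsilon> i \<omega>)"
  define X where "X = \<epsilon> (Suc n)"
  define b where "b = a (Suc n)"
  have ins: "{1..Suc n} = insert (Suc n) {1..n}" by auto
  have IH: "prob {\<omega> \<in> space M. S \<omega> \<ge> y} = rad_tail (map a (rev [1..<Suc n])) y" for y
    unfolding S_def
    by (rule Suc.IH[OF indep_vars_subset[OF Suc.prems(1)] Suc.prems(2) Suc.prems(3)]) auto
  \<comment> \<open>Weight 1 at the last index keeps the bare sign there, so the independence
    obtained is that of this sign and the weighted sum of the others.\<close>
  have "indep_vars (\<lambda>_. borel) (\<lambda>i \<omega>. (if i = Suc n then 1 else a i) * \<epsilon> i \<omega>) {1..Suc n}"
    using indep_vars_compose2[OF Suc.prems(1), of "\<lambda>i y. (if i = Suc n then 1 else a i) * y" "\<lambda>_. borel"]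
    by simp
  then have "indep_var borel (\<lambda>\<omega>. (if Suc n = Suc n then 1 else a (Suc n)) * \<epsilon> (Suc n) \<omega>)
      borel (\<lambda>\<omega>. \<Sum>i\<in>{1..n}. (if i = Suc n then 1 else a i) * \<epsilon> i \<omega>)"
    unfolding ins by (intro indep_vars_sum) auto
  moreover have "(\<Sum>i\<in>{1..n}. (if i = Suc n then 1 else a i) * \<epsilon> i \<omega>) = S \<omega>" for \<omega>
    unfolding S_def by (intro sum.cong) auto
  ultimately have ind: "indep_var borel X borel S" by (simp add: X_def)
  have [measurable]: "random_variable borel X" "random_variable borel S"
    using indep_var_rv1[OF ind] indep_var_rv2[OF ind] .
  have half: "prob {\<omega> \<in> space M. X \<omega> = c \<and> S \<omega> \<ge> y} = 1 / 2 * prob {\<omega> \<in> space M. S \<omega> \<ge> y}"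
    if "c = 1 \<or> c = - 1" for c y
  proof -
    have "prob {\<omega> \<in> space M. X \<omega> = c \<and> S \<omega> \<ge> y} = prob ((\<lambda>\<omega>. (X \<omega>, S \<omega>)) -` ({c} \<times> {y..}) \<inter> space M)"
      by (rule arg_cong[where f = prob]) auto
    also have "\<dots> = prob (X -` {c} \<inter> space M) * prob (S -` {y..} \<inter> space M)"
      by (rule indep_varD[OF ind]) auto
    also have "X -` {c} \<inter> space M = {\<omega> \<in> space M. X \<omega> = c}" by auto
    also have "S -` {y..} \<inter> space M = {\<omega> \<in> space M. S \<omega> \<ge> y}" by auto
    also have "prob {\<omega> \<in> space M. X \<omega> = c} = 1 / 2"
      using that Suc.prems(2,3)[of "Suc n"] by (auto simp: X_def)
    finally show ?thesis .
  qed
  \<comment> \<open>The masses at 1 and -1 add up to 1, so no other value occurs almost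
    surely.\<close>
  have "prob ({\<omega> \<in> space M. X \<omega> = 1} \<union> {\<omega> \<in> space M. X \<omega> = - 1})
      = prob {\<omega> \<in> space M. X \<omega> = 1} + prob {\<omega> \<in> space M. X \<omega> = - 1}"
    by (rule finite_measure_Union) auto
  then have "prob ({\<omega> \<in> space M. X \<omega> = 1} \<union> {\<omega> \<in> space M. X \<omega> = - 1}) = 1"
    using Suc.prems(2,3)[of "Suc n"] by (simp add: X_def)
  then have "AE \<omega> in M. \<omega> \<in> {\<omega> \<in> space M. X \<omega> = 1} \<union> {\<omega> \<in> space M. X \<omega> = - 1}"
    by (subst (asm) prob_eq_1) auto
  then have ae: "AE \<omega> in M. X \<omega> = 1 \<or> X \<omega> = - 1" by eventually_elim auto
  have "prob {\<omega> \<in> space M. S \<omega> + b * X \<omega> \<ge> x}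
      = prob ({\<omega> \<in> space M. X \<omega> = 1 \<and> S \<omega> \<ge> x - b} \<union> {\<omega> \<in> space M. X \<omega> = - 1 \<and> S \<omega> \<ge> x + b})"
    by (rule finite_measure_eq_AE) (use ae in eventually_elim, auto)
  also have "\<dots> = prob {\<omega> \<in> space M. X \<omega> = 1 \<and> S \<omega> \<ge> x - b} + prob {\<omega> \<in> space M. X \<omega> = - 1 \<and> S \<omega> \<ge> x + b}"
    by (rule finite_measure_Union) auto
  also have "\<dots> = rad_tail (map a (rev [1..<Suc (Suc n)])) x"
    by (simp add: half IH rad_tail_Cons b_def)
  finally show ?case by (simp add: S_def X_def b_def)
qed

lemma (in prob_space) prob_normal_tail:
  assumes "distributed M lborel \<eta> std_normal_density"
  shows "\<P>(\<omega> in M. \<eta> \<omega> \<ge> x) = normal_tail x"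
proof -
  have [measurable]: "\<eta> \<in> borel_measurable M"
    using distributed_measurable[OF assms] by simp
  have "\<P>(\<omega> in M. \<eta> \<omega> \<ge> x) = measure (distr M lborel \<eta>) {x..}"
    by (subst measure_distr) (auto intro!: arg_cong[where f = prob])
  then show ?thesis using distributed_distr_eq_density[OF assms] by (simp add: normal_tail_def)
qed

subsection \<open>Small coefficients\<close>

lemma exp_ge_taylor:
  fixes x :: real
  assumes "x \<ge> 0"
  shows "(\<Sum>k<n. x ^ k / fact k) \<le> exp x"
proof -
  obtain t where "exp x = (\<Sum>k<n. x ^ k / fact k) + (exp t / fact n) * x ^ n"
    using Maclaurin_exp_le[of x n] by blast
  then show ?thesis using assms by simp
qed

text \<open>Take logarithms: the difference has derivative t - tan t, which is nonpositive on the
  interval.\<close>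

lemma cos_le_exp_square:
  fixes u :: real
  assumes "\<bar>u\<bar> < pi / 2"
  shows "cos u \<le> exp (- (u\<^sup>2 / 2))"
proof -
  have *: "cos y \<le> exp (- (y\<^sup>2 / 2))" if "0 \<le> y" "y < pi / 2" for y :: real
  proof -
    let ?F = "\<lambda>y. ln (cos y) + y\<^sup>2 / 2"
    have "?F y \<le> ?F 0"
    proof (rule DERIV_nonpos_imp_nonincreasing[OF that(1)])
      fix t :: real assume t: "0 \<le> t" "t \<le> y"
      then have pos: "cos t > 0" using that by (intro cos_gt_zero_pi) auto
      then have "(?F has_real_derivative t - tan t) (at t)"
        by (auto intro!: derivative_eq_intros simp: tan_def)
      moreover have "t \<le> tan t"
        using abs_tan_ge[of t] t that tan_gt_zero[of t] by (cases "t = 0") auto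
      ultimately show "\<exists>d. (?F has_real_derivative d) (at t) \<and> d \<le> 0" by force
    qed
    then have "ln (cos y) \<le> - (y\<^sup>2 / 2)" by simp
    moreover have "cos y > 0" using that by (intro cos_gt_zero_pi) auto
    ultimately show ?thesis by (metis exp_le_cancel_iff exp_ln)
  qed
  show ?thesis using *[of u] *[of "- u"] assms by (cases "u \<ge> 0") auto
qed

text \<open>A reverse Gaussian bound for small angles, at the price of raising 1/2 to 13/25. The
  range 183/500 is 61/50 * 3/10. With v = u^2 / 2 it suffices that exp (- (26/25) * v) <= 1 - v <=
  cos u.\<close>

lemma cos_ge_exp_square:
  fixes u :: real
  assumes "\<bar>u\<bar> \<le> (183/500)"
  shows "exp (- ((13/25) * u\<^sup>2)) \<le> cos u"
proof -
  define v where "v = u\<^sup>2 / 2"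
  have v: "0 \<le> v" "v \<le> (67/1000)"
    using power_mono[OF assms, of 2] by (auto simp: v_def power2_eq_square)
  have "1 + (26/25) * v + ((26/25) * v)\<^sup>2 / 2 \<le> exp ((26/25) * v)"
    using v by (intro exp_lower_Taylor_quadratic) auto
  then have "(1 + (26/25) * v + ((26/25) * v)\<^sup>2 / 2) * (1 - v) \<le> exp ((26/25) * v) * (1 - v)"
    using v by (intro mult_right_mono) auto
  moreover have "(1 + (26/25) * v + ((26/25) * v)\<^sup>2 / 2) * (1 - v)
      = 1 + v * ((1/25) - (312/625) * v - (338/625) * (v * v))"
    by (simp add: power2_eq_square field_simps)
  moreover have "v * v \<le> (67/1000) * (67/1000)" using v by (intro mult_mono) auto
  then have "v * ((1/25) - (312/625) * v - (338/625) * (v * v)) \<ge> 0"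
    using v by (intro mult_nonneg_nonneg) auto
  ultimately have "1 \<le> exp ((26/25) * v) * (1 - v)" by linarith
  then have "exp (- ((26/25) * v)) \<le> 1 - v" by (simp add: exp_minus field_simps)
  also have "1 - v \<le> cos u"
  proof -
    have "(sin (u / 2))\<^sup>2 \<le> (u / 2)\<^sup>2"
      using abs_sin_x_le_abs_x[of "u / 2"] by (rule abs_le_square_iff[THEN iffD1])
    moreover have "cos u = 1 - 2 * (sin (u / 2))\<^sup>2" using cos_double_sin[of "u / 2"] by simp
    ultimately show ?thesis by (simp add: v_def power2_eq_square)
  qed
  finally show ?thesis by (simp add: v_def)
qed

lemma prod_list_map_mono:
  fixes f g :: "'a \<Rightarrow> real"
  assumes "\<And>x. x \<in> set xs \<Longrightarrow> 0 \<le> f x \<and> f x \<le> g x"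
  shows "(\<Prod>x\<leftarrow>xs. f x) \<le> (\<Prod>x\<leftarrow>xs. g x)"
proof -
  have "0 \<le> (\<Prod>x\<leftarrow>xs. f x) \<and> (\<Prod>x\<leftarrow>xs. f x) \<le> (\<Prod>x\<leftarrow>xs. g x)"
    using assms
  proof (induction xs)
    case (Cons x xs)
    then have "0 \<le> f x" "f x \<le> g x" "0 \<le> (\<Prod>x\<leftarrow>xs. f x)" "(\<Prod>x\<leftarrow>xs. f x) \<le> (\<Prod>x\<leftarrow>xs. g x)" by auto
    then show ?case by (auto intro!: mult_mono)
  qed simp
  then show ?thesis by simp
qed

lemma prod_list_exp: "(\<Prod>x\<leftarrow>xs. exp (f x)) = exp (\<Sum>x\<leftarrow>xs. f x :: real)"
  by (induction xs) (auto simp: exp_add)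

text \<open>The numbers \<open>4/5\<close> and \<open>61/50\<close> were found by numerically optimizing the bound that results
  from the test functions \<open>(b - cos (h * s))\<^sup>2\<close> for Gaussian \<open>s\<close> and \<open>x\<close> in \<open>[sqrt 2, sqrt 3]\<close>.\<close>

lemma rad_exp_trig_moment:
  assumes small: "\<And>a. a \<in> set as \<Longrightarrow> \<bar>a\<bar> \<le> (3/10)" and norm: "(\<Sum>a\<leftarrow>as. a\<^sup>2) = 1"
  shows "rad_exp as (\<lambda>s. ((4/5) - cos ((61/50) * s))\<^sup>2) \<le> (861/2000)"
proof -
  \<comment> \<open>48373/62500 = 13/25 * (61/50)^2; below, 3721/1250 = (61/25)^2 / 2.\<close>
  have "exp (- (48373/62500)) = (\<Prod>a\<leftarrow>as. exp (- ((13/25) * ((61/50) * a)\<^sup>2)))"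
  proof -
    have "(\<Sum>a\<leftarrow>as. - ((13/25) * ((61/50) * a)\<^sup>2)) = - (48373/62500) * (\<Sum>a\<leftarrow>as. a\<^sup>2)"
      by (subst sum_list_const_mult[symmetric])
        (intro arg_cong[where f = sum_list] map_cong, auto simp: power_mult_distrib power2_eq_square)
    then show ?thesis by (simp add: prod_list_exp norm)
  qed
  also have "\<dots> \<le> (\<Prod>a\<leftarrow>as. cos ((61/50) * a))"
  proof (rule prod_list_map_mono)
    fix a assume "a \<in> set as"
    then have "\<bar>(61/50) * a\<bar> \<le> (183/500)" using small[of a] by (simp add: abs_mult)
    then show "0 \<le> exp (- ((13/25) * ((61/50) * a)\<^sup>2)) \<and> exp (- ((13/25) * ((61/50) * a)\<^sup>2)) \<le> cos ((61/50) * a)"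
      using cos_ge_exp_square[of "(61/50) * a"] by simp
  qed
  finally have 1: "exp (- (48373/62500)) \<le> rad_exp as (\<lambda>s. cos ((61/50) * s))"
    by (simp only: rad_exp_cos)
  have pi: "(183/250) < pi / 2" using pi_gt3 by simp
  have "(\<Prod>a\<leftarrow>as. cos ((61/25) * a)) \<le> (\<Prod>a\<leftarrow>as. exp (- (((61/25) * a)\<^sup>2 / 2)))"
  proof (rule prod_list_map_mono)
    fix a assume "a \<in> set as"
    then have lt: "\<bar>(61/25) * a\<bar> < pi / 2" using small[of a] pi by (auto simp: abs_mult)
    then have "- (pi / 2) < (61/25) * a" "(61/25) * a < pi / 2" by linarith+
    then have "0 < cos ((61/25) * a)" by (rule cos_gt_zero_pi)
    with cos_le_exp_square[OF lt]
    show "0 \<le> cos ((61/25) * a) \<and> cos ((61/25) * a) \<le> exp (- (((61/25) * a)\<^sup>2 / 2))" by linarith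
  qed
  also have "\<dots> = exp (- (3721/1250))"
  proof -
    have "(\<Sum>a\<leftarrow>as. - (((61/25) * a)\<^sup>2 / 2)) = - (3721/1250) * (\<Sum>a\<leftarrow>as. a\<^sup>2)"
      by (subst sum_list_const_mult[symmetric])
        (intro arg_cong[where f = sum_list] map_cong, auto simp: power_mult_distrib power2_eq_square)
    then show ?thesis by (simp add: prod_list_exp norm)
  qed
  finally have 2: "rad_exp as (\<lambda>s. cos ((61/25) * s)) \<le> exp (- (3721/1250))"
    by (simp only: rad_exp_cos)
  have 3: "exp (- (48373/62500)) \<ge> ((23/50) :: real)"
  proof -
    have "(\<Sum>k<6. (- (48373/62500)) ^ k / fact k) \<le> exp (- (48373/62500) :: real)"
      by (rule exp_minus_bounds) auto
    moreover have "(\<Sum>k<6. (- (48373/62500) :: real) ^ k / fact k) \<ge> (23/50)"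
      by (simp add: eval_nat_numeral fact_numeral)
    ultimately show ?thesis by linarith
  qed
  have 4: "exp (- (3721/1250)) \<le> ((53/1000) :: real)"
  proof -
    \<comment> \<open>A quarter of the exponent needs only four Taylor terms; the fourth power
      restores it.\<close>
    have "((2087/1000) :: real) \<le> (\<Sum>k<4. (3721/5000) ^ k / fact k)"
      by (simp add: eval_nat_numeral)
    also have "\<dots> \<le> exp (3721/5000)" by (rule exp_ge_taylor) simp
    finally have "((2087/1000) :: real) ^ 4 \<le> exp (3721/5000) ^ 4" by (intro power_mono) auto
    also have "exp (3721/5000) ^ 4 = exp ((3721/1250) :: real)" by (simp flip: exp_of_nat_mult)
    finally have "1 / (53/1000) \<le> exp ((3721/1250) :: real)" by (simp add: power_divide)
    then show ?thesis by (simp add: exp_minus field_simps)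
  qed
  \<comment> \<open>Squaring and doubling the angle leaves a negative coefficient at the single
    angle and a positive one at the double angle. Hence a lower bound was needed for the first
    cosine moment and an upper bound for the second.\<close>
  have "((4/5) - cos ((61/50) * s))\<^sup>2 = (57/50) + ((- (8/5)) * cos ((61/50) * s) + (1/2) * cos ((61/25) * s))" for s :: real
    using cos_double_cos[of "(61/50) * s"] by (simp add: power2_eq_square algebra_simps)
  then have "rad_exp as (\<lambda>s. ((4/5) - cos ((61/50) * s))\<^sup>2)
      = (57/50) + ((- (8/5)) * rad_exp as (\<lambda>s. cos ((61/50) * s)) + (1/2) * rad_exp as (\<lambda>s. cos ((61/25) * s)))"
    by (simp only: rad_exp_add rad_exp_cmult rad_exp_const)
  then show ?thesis using 1 2 3 4 by linarith
qed

text \<open>On \<open>x \<le> \<bar>s\<bar> < X\<close>, where \<open>X = 2 * pi / h - x\<close>, the test function is at least its value at \<open>x\<close>;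
  beyond \<open>X\<close> Hoeffding's bound is small enough.\<close>

lemma rad_tail_small_coeffs:
  assumes small: "\<And>a. a \<in> set as \<Longrightarrow> \<bar>a\<bar> \<le> (3/10)" and norm: "(\<Sum>a\<leftarrow>as. a\<^sup>2) = 1"
    and x: "(129/100) \<le> x" "x \<le> (17321/10000)"
  shows "rad_tail as x \<le> (9/40) / ((4/5) - cos ((61/50) * x))\<^sup>2"
proof -
  define g where "g = (4/5) - cos ((61/50) * x)"
  define X where "X = 2 * pi / (61/50) - x"
  have hx: "pi / 2 \<le> (61/50) * x" "(61/50) * x \<le> pi" using x pi_approx by simp_all
  have "cos ((61/50) * x) \<le> cos (pi / 2)" using hx by (subst cos_mono_le_eq) auto
  then have g: "(4/5) \<le> g" "g \<le> (9/5)" using cos_ge_minus_one[of "(61/50) * x"]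
    unfolding g_def by (simp_all only: cos_pi_half)
  have X: "X \<ge> (3417/1000)" using x pi_approx by (simp add: X_def)
  let ?f = "\<lambda>s. 1 / g\<^sup>2 * ((4/5) - cos ((61/50) * s))\<^sup>2 + (of_bool (s \<ge> X) + of_bool (- s \<ge> X)) :: real"
  have "rad_tail as x \<le> rad_exp as ?f / 2"
  proof (rule rad_tail_le_majorant)
    fix s :: real
    show "of_bool (s \<ge> x) + of_bool (- s \<ge> x) \<le> ?f s"
    proof (cases "x \<le> \<bar>s\<bar>")
      case False
      then have "(of_bool (s \<ge> x) + of_bool (- s \<ge> x) :: real) = 0" by (auto simp: abs_less_iff)
      then show ?thesis by simp
    next
      case True
      have "(of_bool (s \<ge> x) + of_bool (- s \<ge> x) :: real) \<le> 1" using x by auto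
      also have "1 \<le> ?f s"
      proof (cases "X \<le> \<bar>s\<bar>")
        case True
        then have "(1 :: real) \<le> of_bool (s \<ge> X) + of_bool (- s \<ge> X)" by (auto simp: abs_if split: if_splits)
        moreover have "0 \<le> 1 / g\<^sup>2 * ((4/5) - cos ((61/50) * s))\<^sup>2" by simp
        ultimately show ?thesis by linarith
      next
        case False
        have "cos ((61/50) * \<bar>s\<bar>) \<le> cos ((61/50) * x)"
        proof (cases "(61/50) * \<bar>s\<bar> \<le> pi")
          case le: True
          then show ?thesis using True hx by (subst cos_mono_le_eq) auto
        next
          case gt: False
          \<comment> \<open>Beyond pi, reflect the angle about pi; since the absolute value of s is
            below X, the reflected angle is still at least that of x.\<close>
          have "2 * pi - (61/50) * \<bar>s\<bar> \<ge> (61/50) * x" using False by (simp add: X_def field_simps)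
          then have "cos (2 * pi - (61/50) * \<bar>s\<bar>) \<le> cos ((61/50) * x)"
            using gt hx by (subst cos_mono_le_eq) auto
          then show ?thesis by (simp add: cos_diff)
        qed
        moreover have "cos ((61/50) * \<bar>s\<bar>) = cos ((61/50) * s)" by (simp add: abs_if)
        ultimately have "g \<le> (4/5) - cos ((61/50) * s)" by (simp add: g_def)
        then have "g\<^sup>2 \<le> ((4/5) - cos ((61/50) * s))\<^sup>2" using g by (intro power_mono) auto
        then have "1 \<le> 1 / g\<^sup>2 * ((4/5) - cos ((61/50) * s))\<^sup>2" using g by simp
        then show ?thesis by simp
      qed
      finally show ?thesis .
    qed
  qed
  also have "rad_exp as ?f = 1 / g\<^sup>2 * rad_exp as (\<lambda>s. ((4/5) - cos ((61/50) * s))\<^sup>2) + 2 * rad_tail as X"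
    using rad_exp_uminus[of as "\<lambda>s. of_bool (s \<ge> X)"]
    by (simp only: rad_exp_add rad_exp_cmult rad_tail_def)
  also have "\<dots> / 2 \<le> (1 / g\<^sup>2 * (861/2000) + 2 * (3/1000)) / 2"
  proof -
    have "rad_tail as X \<le> exp (- X\<^sup>2 / 2)" using X norm by (intro rad_tail_hoeffding) auto
    also have "\<dots> \<le> exp (- (583/100))" using power_mono[OF X, of 2] by (simp add: power2_eq_square)
    also have "\<dots> \<le> (3/1000)"
    proof -
      \<comment> \<open>583/200 is half of the exponent, restored by squaring.\<close>
      have "((183/10) :: real) \<le> (\<Sum>k<9. (583/200) ^ k / fact k)" by (simp add: eval_nat_numeral)
      also have "\<dots> \<le> exp (583/200)" by (rule exp_ge_taylor) simp
      finally have "((183/10) :: real) ^ 2 \<le> exp (583/200) ^ 2" by (intro power_mono) auto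
      also have "exp (583/200) ^ 2 = exp ((583/100) :: real)" by (simp flip: exp_of_nat_mult)
      finally show ?thesis by (simp add: exp_minus field_simps power_divide)
    qed
    finally have "rad_tail as X \<le> (3/1000)" .
    moreover have "1 / g\<^sup>2 * rad_exp as (\<lambda>s. ((4/5) - cos ((61/50) * s))\<^sup>2) \<le> 1 / g\<^sup>2 * (861/2000)"
      using rad_exp_trig_moment[OF small norm] by (intro mult_left_mono) auto
    ultimately show ?thesis by simp
  qed
  \<comment> \<open>After multiplying by g^2 <= (9/5)^2, this reads 861/4000 + (3/1000) * (81/25) <=
    9/40.\<close>
  also have "\<dots> \<le> (9/40) / g\<^sup>2"
  proof -
    have "g\<^sup>2 \<le> (9/5)\<^sup>2" using g by (intro power_mono) auto
    then show ?thesis using g by (simp add: field_simps power2_eq_square)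
  qed
  finally show ?thesis by (simp add: g_def)
qed

subsection \<open>Comparison with the normal tail\<close>

text \<open>The left side is a Pade approximant of 2 * artanh y, agreeing through order y^3; the
  derivative of the difference is a nonnegative multiple of t^4.\<close>

lemma artanh_ge:
  fixes y :: real
  assumes "0 \<le> y" "y < 1"
  shows "6 * y / (3 - y\<^sup>2) \<le> ln ((1 + y) / (1 - y))"
proof -
  let ?F = "\<lambda>y. ln (1 + y) - ln (1 - y) - 6 * y / (3 - y\<^sup>2)"
  have "?F 0 \<le> ?F y"
  proof (rule DERIV_nonneg_imp_nondecreasing[OF assms(1)])
    fix t assume "0 \<le> t" "t \<le> y"
    then have t: "0 \<le> t" "t < 1" using assms by auto
    then have t2: "t\<^sup>2 < 1" by (simp add: power_less_one_iff)
    have "(?F has_real_derivative 1 / (1 + t) + 1 / (1 - t)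
        - (6 * (3 - t\<^sup>2) + 12 * t\<^sup>2) / (3 - t\<^sup>2)\<^sup>2) (at t)"
      using t t2 by (auto intro!: derivative_eq_intros simp: power2_eq_square)
    also have "1 / (1 + t) + 1 / (1 - t) = 2 / (1 - t\<^sup>2)"
      using t t2 by (simp add: field_simps power2_eq_square)
    also have "2 / (1 - t\<^sup>2) - (6 * (3 - t\<^sup>2) + 12 * t\<^sup>2) / (3 - t\<^sup>2)\<^sup>2
        = 8 * t ^ 4 / ((1 - t\<^sup>2) * (3 - t\<^sup>2)\<^sup>2)"
      using t2 by (simp add: divide_simps) algebra
    finally have "(?F has_real_derivative 8 * t ^ 4 / ((1 - t\<^sup>2) * (3 - t\<^sup>2)\<^sup>2)) (at t)" .
    moreover have "8 * t ^ 4 / ((1 - t\<^sup>2) * (3 - t\<^sup>2)\<^sup>2) \<ge> 0"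
      using t2 by (intro divide_nonneg_nonneg mult_nonneg_nonneg) auto
    ultimately show "\<exists>d. (?F has_real_derivative d) (at t) \<and> d \<ge> 0" by blast
  qed
  then show ?thesis using assms by (simp add: ln_div)
qed

text \<open>With \<open>y = x * t\<close>, so that \<open>t\<^sup>2 \<le> y\<^sup>2 / 3\<close>, the ratio of the two densities is
  \<open>exp (2 * y / (1 - t\<^sup>2)) \<le> exp (6 * y / (3 - y\<^sup>2)) \<le> (1 + y) / (1 - y)\<close>.\<close>

lemma shifted_tail_derivative_sign:
  fixes x t :: real
  assumes "sqrt 3 \<le> x" "0 \<le> t" "t < 1"
  shows "(1 - x * t) * std_normal_density ((x - t) / sqrt (1 - t\<^sup>2))
    \<le> (1 + x * t) * std_normal_density ((x + t) / sqrt (1 - t\<^sup>2))"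
proof (cases "x * t \<ge> 1")
  case True
  then have "(1 - x * t) * std_normal_density ((x - t) / sqrt (1 - t\<^sup>2)) \<le> 0"
    by (intro mult_nonpos_nonneg) auto
  also have "0 \<le> (1 + x * t) * std_normal_density ((x + t) / sqrt (1 - t\<^sup>2))"
    using True by (intro mult_nonneg_nonneg) auto
  finally show ?thesis .
next
  case False
  define y where "y = x * t"
  have x: "0 < x" "3 \<le> x\<^sup>2"
    using assms(1) real_sqrt_gt_zero[of 3] power_mono[OF assms(1), of 2] by (linarith, simp)
  have y: "0 \<le> y" "y < 1" using False assms x by (auto simp: y_def)
  have t2: "t\<^sup>2 < 1" using assms by (simp add: power_less_one_iff)
  have "3 * t\<^sup>2 \<le> x\<^sup>2 * t\<^sup>2" using x by (intro mult_right_mono) auto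
  then have "3 * t\<^sup>2 \<le> y\<^sup>2" by (simp add: y_def power_mult_distrib)
  then have "2 * y / (1 - t\<^sup>2) \<le> 2 * y / (1 - y\<^sup>2 / 3)"
    using y by (intro divide_left_mono mult_pos_pos) (auto simp: power_less_one_iff t2 intro: order.strict_trans2[of _ 1])
  also have "\<dots> = 6 * y / (3 - y\<^sup>2)" by (simp add: field_simps)
  also have "\<dots> \<le> ln ((1 + y) / (1 - y))" using y by (rule artanh_ge)
  finally have "exp (2 * y / (1 - t\<^sup>2)) \<le> (1 + y) / (1 - y)"
    using y by (simp add: ln_ge_iff)
  then have *: "(1 - y) * exp (2 * y / (1 - t\<^sup>2)) \<le> 1 + y" using y by (simp add: field_simps)
  have sq: "(z / sqrt (1 - t\<^sup>2))\<^sup>2 = z\<^sup>2 / (1 - t\<^sup>2)" for z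
    using t2 by (simp add: power_divide)
  have "- ((x - t) / sqrt (1 - t\<^sup>2))\<^sup>2 / 2 = - ((x + t) / sqrt (1 - t\<^sup>2))\<^sup>2 / 2 + 2 * y / (1 - t\<^sup>2)"
    unfolding sq y_def using t2 by (simp add: divide_simps) algebra
  then have "std_normal_density ((x - t) / sqrt (1 - t\<^sup>2))
      = std_normal_density ((x + t) / sqrt (1 - t\<^sup>2)) * exp (2 * y / (1 - t\<^sup>2))"
    by (simp only: std_normal_density_def exp_add mult.assoc)
  then show ?thesis
    using mult_left_mono[OF *, of "std_normal_density ((x + t) / sqrt (1 - t\<^sup>2))"]
    by (simp add: y_def mult_ac)
qed

text \<open>The two sides agree at t = 0, and by \<open>shifted_tail_derivative_sign\<close> the
  left side is nonincreasing in t. This is what closes the induction on the number of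
  coefficients.\<close>

lemma normal_tail_superharmonic:
  fixes x t :: real
  assumes x: "sqrt 3 \<le> x" and t: "0 \<le> t" "t < 1"
  shows "normal_tail ((x - t) / sqrt (1 - t\<^sup>2)) + normal_tail ((x + t) / sqrt (1 - t\<^sup>2))
    \<le> 2 * normal_tail x"
proof -
  let ?F = "\<lambda>t. normal_tail ((x - t) / sqrt (1 - t\<^sup>2)) + normal_tail ((x + t) / sqrt (1 - t\<^sup>2))"
  have "?F t \<le> ?F 0"
  proof (rule DERIV_nonpos_imp_nonincreasing[OF t(1)])
    fix u assume "0 \<le> u" "u \<le> t"
    then have u: "0 \<le> u" "u < 1" using t by auto
    define r where "r = sqrt (1 - u\<^sup>2)"
    have u2: "u\<^sup>2 < 1" using u by (simp add: power_less_one_iff)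
    then have r: "r > 0" "r\<^sup>2 = 1 - u\<^sup>2" by (simp_all add: r_def)
    have d0: "((\<lambda>u. sqrt (1 - u\<^sup>2)) has_real_derivative - u / r) (at u)"
      using u2 by (auto intro!: derivative_eq_intros simp: r_def field_simps)
    have d1: "((\<lambda>u. (x - u) / sqrt (1 - u\<^sup>2)) has_real_derivative (x * u - 1) / r ^ 3) (at u)"
    proof -
      have "((\<lambda>u. (x - u) / sqrt (1 - u\<^sup>2)) has_real_derivative
          ((0 - 1) * r - (x - u) * (- u / r)) / (r * r)) (at u)"
        unfolding r_def
        by (rule DERIV_divide) (use r d0 in \<open>auto intro!: derivative_eq_intros simp: r_def\<close>)
      also have "((0 - 1) * r - (x - u) * (- u / r)) / (r * r) = (x * u - 1) / r ^ 3"
      proof -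
        have "((0 - 1) * r - (x - u) * (- u / r)) / (r * r) = (x * u - u\<^sup>2 - r\<^sup>2) / r ^ 3"
          using r(1) by (simp add: field_simps power2_eq_square power3_eq_cube)
        then show ?thesis by (simp add: r(2))
      qed
      finally show ?thesis .
    qed
    have d2: "((\<lambda>u. (x + u) / sqrt (1 - u\<^sup>2)) has_real_derivative (x * u + 1) / r ^ 3) (at u)"
    proof -
      have "((\<lambda>u. (x + u) / sqrt (1 - u\<^sup>2)) has_real_derivative
          ((0 + 1) * r - (x + u) * (- u / r)) / (r * r)) (at u)"
        unfolding r_def
        by (rule DERIV_divide) (use r d0 in \<open>auto intro!: derivative_eq_intros simp: r_def\<close>)
      also have "((0 + 1) * r - (x + u) * (- u / r)) / (r * r) = (x * u + 1) / r ^ 3"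
      proof -
        have "((0 + 1) * r - (x + u) * (- u / r)) / (r * r) = (x * u + u\<^sup>2 + r\<^sup>2) / r ^ 3"
          using r(1) by (simp add: field_simps power2_eq_square power3_eq_cube)
        then show ?thesis by (simp add: r(2))
      qed
      finally show ?thesis .
    qed
    let ?p = "std_normal_density ((x - u) / sqrt (1 - u\<^sup>2))"
    let ?q = "std_normal_density ((x + u) / sqrt (1 - u\<^sup>2))"
    have "(?F has_real_derivative - ?p * ((x * u - 1) / r ^ 3) + - ?q * ((x * u + 1) / r ^ 3)) (at u)"
      by (intro DERIV_add normal_tail_deriv d1 d2)
    also have "- ?p * ((x * u - 1) / r ^ 3) + - ?q * ((x * u + 1) / r ^ 3)
        = ((1 - x * u) * ?p - (1 + x * u) * ?q) / r ^ 3"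
      by (simp add: diff_divide_distrib add_divide_distrib algebra_simps)
    finally have "(?F has_real_derivative ((1 - x * u) * ?p - (1 + x * u) * ?q) / r ^ 3) (at u)" .
    moreover have "((1 - x * u) * ?p - (1 + x * u) * ?q) / r ^ 3 \<le> 0"
      using shifted_tail_derivative_sign[OF x u] r by (intro divide_nonpos_nonneg) auto
    ultimately show "\<exists>d. (?F has_real_derivative d) (at u) \<and> d \<le> 0" by blast
  qed
  then show ?thesis by simp
qed

section \<open>The range up to sqrt 3\<close>

lemma rad_tail_le_normal_tail_mid:
  assumes norm: "(\<Sum>a\<leftarrow>as. a\<^sup>2) = 1" and x: "sqrt 2 \<le> x" "x \<le> sqrt 3"
  shows "4 * normal_tail (sqrt 2) * rad_tail as x \<le> normal_tail x"
proof -
  have "as \<noteq> []" using norm by auto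
  then have "Max (abs ` set as) \<in> abs ` set as" by (intro Max_in) auto
  then obtain b where b: "b \<in> set as" "\<bar>b\<bar> = Max (abs ` set as)" by force
  have max: "\<bar>a\<bar> \<le> \<bar>b\<bar>" if "a \<in> set as" for a
    unfolding b(2) using that by (intro Max_ge) auto
  define t where "t = \<bar>b\<bar>"
  obtain us vs where as: "as = us @ b # vs" using b(1) by (meson split_list)
  have tail: "rad_tail as x = rad_tail (t # us @ vs) x"
    unfolding as t_def by (simp only: rad_tail_insert rad_tail_Cons_abs)
  have sum: "t\<^sup>2 + (\<Sum>a\<leftarrow>us @ vs. a\<^sup>2) = 1" using norm by (simp add: as t_def)
  have nonneg: "(\<Sum>a\<leftarrow>us @ vs. a\<^sup>2) \<ge> 0" by (intro sum_list_nonneg) auto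
  have x14: "(707/500) \<le> x" "x \<le> (17321/10000)" using x sqrt_bounds by simp_all
  have "t\<^sup>2 \<le> 1" using sum nonneg by linarith
  then have t: "0 \<le> t" "t \<le> 1" by (simp_all add: t_def abs_square_le_1)
  have I: "0 \<le> normal_tail (sqrt 2)" by (rule normal_tail_nonneg)
  show ?thesis
  \<comment> \<open>This is the level condition of \<open>rad_tail_large_coeff\<close> for the
    largest coefficient t.\<close>
  proof (cases "2 * (x - t)\<^sup>2 \<le> (x + t)\<^sup>2")
    case True
    have "rad_tail as x \<le> 1 / (4 * (x\<^sup>2 - 1))"
      unfolding tail using True t x14 sum by (intro rad_tail_large_coeff) auto
    then have "4 * normal_tail (sqrt 2) * rad_tail as x \<le> 4 * normal_tail (sqrt 2) * (1 / (4 * (x\<^sup>2 - 1)))"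
      using I by (intro mult_left_mono) auto
    also have "\<dots> = normal_tail (sqrt 2) / (x\<^sup>2 - 1)"
      by (simp only: times_divide_eq_right mult_1_right mult_divide_mult_cancel_left_if) simp
    also have "\<dots> \<le> normal_tail x"
    proof -
      have "x\<^sup>2 > 1" using x14 by (simp add: one_less_power)
      then show ?thesis using normal_tail_ge_chebyshev2[OF x] by (simp add: field_simps)
    qed
    finally show ?thesis .
  next
    case False
    \<comment> \<open>Failure of the level condition gives t < x * (sqrt 2 - 1) / (sqrt 2 + 1),
      about 0.297 at x = sqrt 3. The number 14143/10000 below is a rational slightly above sqrt
      2.\<close>
    have "t \<le> (3/10)"
    proof (rule ccontr)
      assume "\<not> t \<le> (3/10)"
      then have "(14143/10000) * (x - t) \<le> x + t" using x14 by simp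
      then have "((14143/10000) * (x - t))\<^sup>2 \<le> (x + t)\<^sup>2" using t x14 by (intro power_mono) auto
      moreover have "2 * (x - t)\<^sup>2 \<le> ((14143/10000) * (x - t))\<^sup>2"
        unfolding power_mult_distrib by (intro mult_right_mono) (auto simp: power2_eq_square)
      ultimately show False using False by linarith
    qed
    then have small: "\<bar>a\<bar> \<le> (3/10)" if "a \<in> set as" for a
      using order_trans[OF max[OF that]] by (simp only: t_def)
    define D where "D = ((4/5) - cos ((61/50) * x))\<^sup>2"
    have "rad_tail as x \<le> (9/40) / D"
      unfolding D_def using x14 norm by (intro rad_tail_small_coeffs small) auto
    then have "4 * normal_tail (sqrt 2) * rad_tail as x \<le> 4 * normal_tail (sqrt 2) * ((9/40) / D)"
      by (rule mult_left_mono) (use I in simp)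
    also have "\<dots> = (9/10) * normal_tail (sqrt 2) / D" by simp
    also have "\<dots> \<le> normal_tail x"
    \<comment> \<open>For \<open>D = 0\<close> the quotient is 0 by the division convention, and the
      claim is nonnegativity of the tail.\<close>
    proof (cases "D = 0")
      case False
      then have "D > 0" by (simp add: D_def)
      then show ?thesis
        using normal_tail_ge_trig[OF x] by (simp only: pos_divide_le_eq D_def[symmetric]) (simp only: mult.commute)
    qed (simp add: normal_tail_nonneg)
    finally show ?thesis .
  qed
qed

text \<open>Four ranges with four bounds of the Rademacher tail: 1, then 1/2 by symmetry, then
  Chebyshev, then the large/small coefficient dichotomy.\<close>

lemma rad_tail_le_normal_tail_sqrt3:
  assumes norm: "(\<Sum>a\<leftarrow>as. a\<^sup>2) = 1" and x: "x \<le> sqrt 3"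
  shows "4 * normal_tail (sqrt 2) * rad_tail as x \<le> normal_tail x"
proof -
  have I: "0 \<le> normal_tail (sqrt 2)" by (rule normal_tail_nonneg)
  consider "x \<le> 0" | "0 < x" "x \<le> 1" | "1 < x" "x \<le> sqrt 2" | "sqrt 2 < x" by linarith
  then show ?thesis
  proof cases
    case 1
    have "4 * normal_tail (sqrt 2) * rad_tail as x \<le> 4 * normal_tail (sqrt 2) * 1"
      using I rad_tail_le_1 by (intro mult_left_mono) auto
    then show ?thesis using normal_tail_ge_half[OF 1] normal_tail_sqrt2 by simp
  next
    case 2
    have "4 * normal_tail (sqrt 2) * rad_tail as x \<le> 4 * normal_tail (sqrt 2) * (1 / 2)"
      using I rad_tail_le_half[OF 2(1)] by (intro mult_left_mono) auto
    then show ?thesis using normal_tail_1 normal_tail_antimono[OF 2(2)] by linarith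
  next
    case 3
    have "4 * normal_tail (sqrt 2) * rad_tail as x \<le> 4 * normal_tail (sqrt 2) * (1 / (2 * x\<^sup>2))"
    proof (rule mult_left_mono)
      show "rad_tail as x \<le> 1 / (2 * x\<^sup>2)" using rad_tail_chebyshev[of x as] 3(1) norm by simp
    qed (use I in simp)
    also have "\<dots> = 2 * normal_tail (sqrt 2) / x\<^sup>2" by simp
    also have "\<dots> \<le> normal_tail x"
      using normal_tail_ge_chebyshev[of x] 3 by (simp add: field_simps)
    finally show ?thesis .
  next
    case 4
    then show ?thesis using rad_tail_le_normal_tail_mid[OF norm _ x] by simp
  qed
qed

section \<open>Rescaling and induction on the number of coefficients\<close>

text \<open>Dividing by the Euclidean norm v <= \<open>\<sigma>\<close> moves the level to x / v >=
  x / \<open>\<sigma>\<close>. The premise \<open>unit\<close> is restricted to one length so that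
  an induction hypothesis can supply it.\<close>

lemma rad_tail_le_normal_tail_rescale:
  assumes unit: "\<And>bs y. length bs = length as \<Longrightarrow> (\<Sum>b\<leftarrow>bs. b\<^sup>2) = 1
      \<Longrightarrow> 4 * normal_tail (sqrt 2) * rad_tail bs y \<le> normal_tail y"
    and sum: "(\<Sum>a\<leftarrow>as. a\<^sup>2) \<le> \<sigma>\<^sup>2" and "\<sigma> > 0" "x > 0"
  shows "4 * normal_tail (sqrt 2) * rad_tail as x \<le> normal_tail (x / \<sigma>)"
proof (cases "(\<Sum>a\<leftarrow>as. a\<^sup>2) = 0")
  case True
  then have "rad_tail as x \<le> 0" using rad_tail_chebyshev[OF \<open>x > 0\<close>, of as] by simp
  then have "4 * normal_tail (sqrt 2) * rad_tail as x \<le> 0"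
    using normal_tail_nonneg by (intro mult_nonneg_nonpos) auto
  then show ?thesis using normal_tail_nonneg[of "x / \<sigma>"] by linarith
next
  case False
  define v where "v = sqrt (\<Sum>a\<leftarrow>as. a\<^sup>2)"
  have "(\<Sum>a\<leftarrow>as. a\<^sup>2) \<ge> 0" by (intro sum_list_nonneg) auto
  then have v: "v > 0" "v\<^sup>2 = (\<Sum>a\<leftarrow>as. a\<^sup>2)" using False by (auto simp: v_def)
  have "v \<le> \<sigma>" using sum \<open>\<sigma> > 0\<close> unfolding v_def by (intro real_le_lsqrt) auto
  let ?bs = "map ((*) (1 / v)) as"
  have "(\<Sum>b\<leftarrow>?bs. b\<^sup>2) = (\<Sum>a\<leftarrow>as. 1 / v\<^sup>2 * a\<^sup>2)"
    by (simp add: comp_def power_divide power_mult_distrib)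
  also have "\<dots> = 1 / v\<^sup>2 * (\<Sum>a\<leftarrow>as. a\<^sup>2)" by (rule sum_list_const_mult)
  also have "\<dots> = 1" unfolding v(2)[symmetric] using v(1) by simp
  finally have "4 * normal_tail (sqrt 2) * rad_tail ?bs (1 / v * x) \<le> normal_tail (1 / v * x)"
    by (intro unit) auto
  also have "rad_tail ?bs (1 / v * x) = rad_tail as x" using v by (intro rad_tail_scale) auto
  also have "normal_tail (1 / v * x) \<le> normal_tail (x / \<sigma>)"
    using v \<open>v \<le> \<sigma>\<close> \<open>x > 0\<close> by (intro normal_tail_antimono) (simp add: frac_le)
  finally show ?thesis .
qed

text \<open>Beyond sqrt 3 the head is split off, whatever its size. The other coefficients have norm
  sqrt (1 - t^2), so rescaling the induction hypothesis produces exactly the two terms of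
  \<open>normal_tail_superharmonic\<close>.\<close>

lemma rad_tail_le_normal_tail_unit:
  assumes "(\<Sum>a\<leftarrow>as. a\<^sup>2) = 1"
  shows "4 * normal_tail (sqrt 2) * rad_tail as x \<le> normal_tail x"
  using assms
proof (induction "length as" arbitrary: as x)
  case 0
  then show ?case by simp
next
  case (Suc n)
  show ?case
  proof (cases "x \<le> sqrt 3")
    case True
    then show ?thesis using Suc.prems by (intro rad_tail_le_normal_tail_sqrt3)
  next
    case False
    then have x: "x > (17/10)" "sqrt 3 \<le> x" using sqrt_bounds by simp_all
    obtain a bs where as: "as = a # bs" using Suc.hyps(2) by (cases as) auto
    define t where "t = \<bar>a\<bar>"
    have tail: "rad_tail as x = (rad_tail bs (x - t) + rad_tail bs (x + t)) / 2"
      unfolding as t_def by (rule trans[OF rad_tail_Cons_abs[symmetric] rad_tail_Cons])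
    have sum: "(\<Sum>b\<leftarrow>bs. b\<^sup>2) = 1 - t\<^sup>2" using Suc.prems by (simp add: as t_def)
    have "(\<Sum>b\<leftarrow>bs. b\<^sup>2) \<ge> 0" by (intro sum_list_nonneg) auto
    then have t: "0 \<le> t" "t \<le> 1" using sum by (simp_all add: t_def abs_square_le_1)
    show ?thesis
    proof (cases "t < 1")
      case True
      then have t2: "t\<^sup>2 < 1" using t by (simp add: power_less_one_iff)
      have IH: "4 * normal_tail (sqrt 2) * rad_tail bs y \<le> normal_tail (y / sqrt (1 - t\<^sup>2))" if "y > 0" for y
        using t2 Suc.hyps(2) sum that
        by (intro rad_tail_le_normal_tail_rescale Suc.hyps(1)) (auto simp: as)
      have "4 * normal_tail (sqrt 2) * rad_tail as x
          = (4 * normal_tail (sqrt 2) * rad_tail bs (x - t) + 4 * normal_tail (sqrt 2) * rad_tail bs (x + t)) / 2"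
        unfolding tail by (simp add: algebra_simps)
      also have "\<dots> \<le> (normal_tail ((x - t) / sqrt (1 - t\<^sup>2)) + normal_tail ((x + t) / sqrt (1 - t\<^sup>2))) / 2"
        using t x by (intro divide_right_mono add_mono IH) auto
      also have "\<dots> \<le> normal_tail x"
        using normal_tail_superharmonic[OF x(2) t(1) True] by simp
      finally show ?thesis .
    next
      \<comment> \<open>Here all other coefficients vanish, and both shifted levels are positive
        because x > 1.\<close>
      case False
      then have "t = 1" using t by simp
      then have "rad_tail bs (x - t) \<le> 0" "rad_tail bs (x + t) \<le> 0"
        using rad_tail_chebyshev[of "x - t" bs] rad_tail_chebyshev[of "x + t" bs] x sum by auto
      then have "4 * normal_tail (sqrt 2) * rad_tail as x \<le> 0"
        unfolding tail using normal_tail_nonneg by (intro mult_nonneg_nonpos) auto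
      then show ?thesis using normal_tail_nonneg[of x] by linarith
    qed
  qed
qed

lemma rad_tail_le_normal_tail:
  assumes "(\<Sum>a\<leftarrow>as. a\<^sup>2) \<le> 1"
  shows "4 * normal_tail (sqrt 2) * rad_tail as x \<le> normal_tail x"
proof (cases "x > 0")
  case True
  then show ?thesis
    using rad_tail_le_normal_tail_rescale[of as 1 x] rad_tail_le_normal_tail_unit assms by simp
next
  case False
  have "4 * normal_tail (sqrt 2) * rad_tail as x \<le> 4 * normal_tail (sqrt 2) * 1"
    using normal_tail_nonneg rad_tail_le_1 by (intro mult_left_mono) auto
  then show ?thesis using normal_tail_ge_half[of x] normal_tail_sqrt2 False by simp
qed

theorem theorem1p1:
  fixes M :: "'a measure" and N :: "'b measure"
    and n :: nat and \<epsilon> :: "nat \<Rightarrow> 'a \<Rightarrow> real" and a :: "nat \<Rightarrow> real"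
    and \<eta> :: "'b \<Rightarrow> real"
  assumes "prob_space M" and "prob_space N"
    and "n \<ge> 1"
    and "prob_space.indep_vars M (\<lambda>_. borel) \<epsilon> {1..n}"
    and "\<And>i. i \<in> {1..n} \<Longrightarrow> \<P>(\<omega> in M. \<epsilon> i \<omega> = 1) = 1 / 2"
    and "\<And>i. i \<in> {1..n} \<Longrightarrow> \<P>(\<omega> in M. \<epsilon> i \<omega> = - 1) = 1 / 2"
    and "(\<Sum>i = 1..n. (a i)\<^sup>2) \<le> 1"
    and "distributed N lborel \<eta> std_normal_density"
  shows "\<forall>x::real. \<P>(\<omega> in M. (\<Sum>i = 1..n. a i * \<epsilon> i \<omega>) \<ge> x)
           \<le> c_star * \<P>(\<omega> in N. \<eta> \<omega> \<ge> x)"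
proof
  fix x :: real
  let ?as = "map a (rev [1..<Suc n])"
  have "\<P>(\<omega> in M. (\<Sum>i = 1..n. a i * \<epsilon> i \<omega>) \<ge> x) = rad_tail ?as x"
    by (rule prob_space.prob_rademacher_sum[OF assms(1,4-6)])
  moreover have "\<P>(\<omega> in N. \<eta> \<omega> \<ge> x) = normal_tail x"
    by (rule prob_space.prob_normal_tail[OF assms(2,8)])
  moreover have "(\<Sum>i\<leftarrow>?as. i\<^sup>2) = (\<Sum>i = 1..n. (a i)\<^sup>2)"
    by (simp only: map_map comp_def rev_map[symmetric] sum_list_rev interv_sum_list_conv_sum_set_nat set_upt atLeastLessThanSuc_atLeastAtMost)
  then have "rad_tail ?as x * (4 * normal_tail (sqrt 2)) \<le> normal_tail x"
    using assms(7) rad_tail_le_normal_tail[of ?as x] by (simp only: mult.commute)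
  then have "rad_tail ?as x \<le> 1 / (4 * normal_tail (sqrt 2)) * normal_tail x"
    using normal_tail_pos[of "sqrt 2"] by (simp only: times_divide_eq_left mult_1_left) (rule mult_imp_le_div_pos; simp)
  moreover have "c_star = 1 / (4 * normal_tail (sqrt 2))"
    by (simp add: c_star_def normal_tail_def inverse_eq_divide)
  ultimately show "\<P>(\<omega> in M. (\<Sum>i = 1..n. a i * \<epsilon> i \<omega>) \<ge> x) \<le> c_star * \<P>(\<omega> in N. \<eta> \<omega> \<ge> x)"
    by (simp only:)
qed

end
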